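(* Let $n\ge 1$. Density below is in the sense of weak convergence of probability distributions, and $\mathbb{R}_+=[0,\infty)$. (i) The class of all distributions $\mathrm{MPH}^*_\alpha(\boldsymbol{\pi},\boldsymbol{T},\boldsymbol{R})$ on $\mathbb{R}_+^n$ (over all $\alpha\in(0,1]$, all dimensions $p\ge1$ and all admissible $\boldsymbol{\pi},\boldsymbol{T},\boldsymbol{R}$) is dense in the class of all distributions on $\mathbb{R}_+^n$. (ii) For any fixed $\alpha\in(0,1]$, the class of all distributions $\mathrm{MPH}^{*1/\boldsymbol{\nu}}_\alpha(\boldsymbol{\pi},\boldsymbol{T},\boldsymbol{R})$ (over all $\boldsymbol{\nu}\in(0,\infty)^n$, all $p\ge 1$ and all admissible $\boldsymbol{\pi},\boldsymbol{T},\boldsymbol{R}$) is dense in the class of all distributions on $\mathbb{R}_+^n$. (iii) For any fixed vector of positive tail indices $(c_1,\dots,c_n)\in(0,\infty)^n$, the class of all distributions $\mathrm{MPH}^{*1/\boldsymbol{\nu}}_\alpha(\boldsymbol{\pi},\boldsymbol{T},\boldsymbol{R})$ with $(\alpha\nu_1,\dots,\alpha\nu_n)=(c_1,\dots,c_n)$ (over all $\alpha\in(0,1)$ and $\boldsymbol{\nu}\in(0,\infty)^n$ satisfying this constraint, all $p\ge1$ and all admissible $\boldsymbol{\pi},\boldsymbol{T},\boldsymbol{R}$) is dense in the class of all distributions on $\mathbb{R}_+^n$.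
   Context: Admissible parameters of dimension $p$: $\boldsymbol{\pi}=(\pi_1,\dots,\pi_p)$ is a row vector of probabilities summing to $1$; $\boldsymbol{T}$ is a $p\times p$ sub-intensity matrix of transient states, i.e. with negative diagonal entries, non-negative off-diagonal entries, $\boldsymbol{t}:=-\boldsymbol{T}\boldsymbol{e}\ge \boldsymbol 0$ entrywise ($\boldsymbol{e}$ the column vector of ones), and $\boldsymbol{T}$ invertible; $\boldsymbol{R}$ is a $p\times n$ matrix with non-negative entries. For $\alpha\in(0,1]$, $\mathrm{MPH}^*_\alpha(\boldsymbol{\pi},\boldsymbol{T},\boldsymbol{R})$ (multivariate fractional phase-type distribution) is the distribution of the random vector $\boldsymbol{X}$ with values in $\mathbb{R}_+^n$ characterized by the joint Laplace transform $$\mathbb{E}\left(e^{-\langle\boldsymbol{X},\boldsymbol{\theta}\rangle}\right)=\boldsymbol{\pi}\left(\boldsymbol{\Delta}(\boldsymbol{R}\boldsymbol{\theta})^\alpha-\boldsymbol{T}\right)^{-1}\boldsymbol{t},\qquad \boldsymbol{\theta}\in[0,\infty)^n,$$ where $\boldsymbol{\Delta}(\boldsymbol{R}\boldsymbol{\theta})^\alpha$ is the diagonal matrix with entries $((\boldsymbol{R}\boldsymbol{\theta})_i)^\alpha$, $i=1,\dots,p$ (with $0^\alpha=0$). For $\boldsymbol{\nu}=(\nu_1,\dots,\nu_n)$ with all $\nu_i>0$, $\mathrm{MPH}^{*1/\boldsymbol{\nu}}_\alpha(\boldsymbol{\pi},\boldsymbol{T},\boldsymbol{R})$ is the distribution of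 $\boldsymbol{X}^{1/\boldsymbol{\nu}}=(X_1^{1/\nu_1},\dots,X_n^{1/\nu_n})$ where $\boldsymbol{X}\sim\mathrm{MPH}^*_\alpha(\boldsymbol{\pi},\boldsymbol{T},\boldsymbol{R})$. *)

theory Defs
  imports
    "HOL-Probability.Probability"
    "Jordan_Normal_Form.Gauss_Jordan_Elimination"
begin

text \<open>
  The ambient space of the distributions is \<open>real^'n\<close> (dimension \<open>n = CARD('n) \<ge> 1\<close>).  The phase
  space has a dimension \<open>p\<close> that varies within the statements, so \<open>\<pi>\<close> and \<open>T\<close> are vectors and
  matrices with explicit carriers.  Both libraries use the same infix symbols; here \<open>$\<close> and
  \<open>\<bullet>\<close> refer to \<open>real^'n\<close> only.
\<close>

no_notation Matrix.vec_index (infixl \<open>$\<close> 100)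
no_notation Matrix.scalar_prod (infix \<open>\<bullet>\<close> 70)
notation Matrix.vec_index (infixl \<open>$v\<close> 100)
notation Matrix.scalar_prod (infix \<open>\<bullet>v\<close> 70)

definition ones_vec :: "nat \<Rightarrow> real vec" where
  "ones_vec p = Matrix.vec p (\<lambda>_. 1)"

definition exit_vec :: "real mat \<Rightarrow> real vec" where
  "exit_vec T = - (T *\<^sub>v ones_vec (dim_col T))"

definition probability_vector :: "nat \<Rightarrow> real vec \<Rightarrow> bool" where
  "probability_vector p \<pi> \<longleftrightarrow>
     \<pi> \<in> carrier_vec p \<and> (\<forall>i<p. 0 \<le> \<pi> $v i) \<and> (\<Sum>i<p. \<pi> $v i) = 1"

definition transient_subintensity_matrix :: "nat \<Rightarrow> real mat \<Rightarrow> bool" where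
  "transient_subintensity_matrix p T \<longleftrightarrow>
     T \<in> carrier_mat p p \<and>
     (\<forall>i<p. T $$ (i, i) < 0) \<and>
     (\<forall>i<p. \<forall>j<p. i \<noteq> j \<longrightarrow> 0 \<le> T $$ (i, j)) \<and>
     (\<forall>i<p. 0 \<le> exit_vec T $v i) \<and>
     invertible_mat T"

text \<open>
  The \<open>p \<times> n\<close> reward matrix is given by its rows \<open>R i\<close> for \<open>i < p\<close>, so that the \<open>i\<close>-th entry of
  \<open>R\<theta>\<close> is \<open>R i \<bullet> \<theta>\<close>.  Rows with index \<open>\<ge> p\<close> are never used.
\<close>

definition admissible :: "nat \<Rightarrow> real vec \<Rightarrow> real mat \<Rightarrow> (nat \<Rightarrow> real^'n) \<Rightarrow> bool" where
  "admissible p \<pi> T R \<longleftrightarrow>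
     1 \<le> p \<and> probability_vector p \<pi> \<and> transient_subintensity_matrix p T \<and>
     (\<forall>i<p. \<forall>j. 0 \<le> R i $ j)"

text \<open>
  Distributions on the closed orthant are Borel probability measures on \<open>real^'n\<close> concentrated
  on it.
\<close>

definition orthant_distributions :: "(real^'n) measure set" where
  "orthant_distributions =
     {M. prob_space M \<and> sets M = sets borel \<and> (AE x in M. \<forall>j. 0 \<le> x $ j)}"

text \<open>
  For admissible parameters the matrix inverted below is a nonsingular M-matrix for every
  \<open>\<theta> \<ge> 0\<close>, so \<open>mat_inverse\<close> does not return \<open>None\<close>.  Note \<open>0 powr \<alpha> = 0\<close>.
\<close>

definition mph_laplace ::
  "real \<Rightarrow> real vec \<Rightarrow> real mat \<Rightarrow> (nat \<Rightarrow> real^'n) \<Rightarrow> real^'n \<Rightarrow> real" where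
  "mph_laplace \<alpha> \<pi> T R \<theta> =
     \<pi> \<bullet>v (the (mat_inverse (mat_diag (dim_row T) (\<lambda>i. (R i \<bullet> \<theta>) powr \<alpha>) - T)) *\<^sub>v exit_vec T)"

definition is_MPH_star ::
  "real \<Rightarrow> real vec \<Rightarrow> real mat \<Rightarrow> (nat \<Rightarrow> real^'n) \<Rightarrow> (real^'n) measure \<Rightarrow> bool" where
  "is_MPH_star \<alpha> \<pi> T R M \<longleftrightarrow>
     M \<in> orthant_distributions \<and>
     (\<forall>\<theta>. (\<forall>j. 0 \<le> \<theta> $ j) \<longrightarrow> (\<integral>x. exp (- (x \<bullet> \<theta>)) \<partial>M) = mph_laplace \<alpha> \<pi> T R \<theta>)"

definition is_MPH_star_power ::
  "real^'n \<Rightarrow> real \<Rightarrow> real vec \<Rightarrow> real mat \<Rightarrow> (nat \<Rightarrow> real^'n) \<Rightarrow> (real^'n) measure \<Rightarrow> bool" where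
  "is_MPH_star_power \<nu> \<alpha> \<pi> T R M \<longleftrightarrow>
     (\<exists>L. is_MPH_star \<alpha> \<pi> T R L \<and> M = distr L borel (\<lambda>x. \<chi> j. (x $ j) powr (1 / \<nu> $ j)))"

definition converges_weakly ::
  "(nat \<Rightarrow> 'a::topological_space measure) \<Rightarrow> 'a measure \<Rightarrow> bool" where
  "converges_weakly Ms M \<longleftrightarrow>
     (\<forall>f :: 'a \<Rightarrow> real. continuous_on UNIV f \<and> bounded (range f) \<longrightarrow>
        (\<lambda>k. \<integral>x. f x \<partial>Ms k) \<longlonglongrightarrow> (\<integral>x. f x \<partial>M))"

text \<open>
  The weak topology on probability measures on \<open>real^'n\<close> is metrizable, so density can be expressed
  by sequences.
\<close>

definition weakly_dense_in ::
  "'a::topological_space measure set \<Rightarrow> 'a measure set \<Rightarrow> bool" where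
  "weakly_dense_in A B \<longleftrightarrow>
     A \<subseteq> B \<and> (\<forall>M\<in>B. \<exists>Ms. (\<forall>k::nat. Ms k \<in> A) \<and> converges_weakly Ms M)"

end

theory Submission
  imports Defs "Jordan_Normal_Form.Determinant" "HOL-Real_Asymp.Real_Asymp"
begin

text \<open>
  Every distribution on the orthant is a weak limit of finitely supported ones, so the task is to
  approximate a finite mixture of point masses at vectors \<open>v l\<close>.  The phase-type laws used for this
  are driven by \<open>K\<close> parallel Erlang chains of \<open>m\<close> phases, all with rate \<open>m\<close>; chain \<open>l\<close> is entered with
  probability \<open>w l\<close> and earns the same reward vector \<open>v l\<close> in all its phases.  Solving the bidiagonal
  linear system behind the Laplace transform gives (lemma \<open>mph_laplace_erlang\<close>)
  \<open>\<Sum>l<K. w l * (m / (m + (v l \<bullet> \<theta>) powr \<alpha>)) ^ m\<close>,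
  which is the transform of a random scalar multiple \<open>Y v\<close> of a random vector \<open>v\<close> with
  \<open>P(v = v l) = w l\<close>, where \<open>Y \<ge> 0\<close> is independent of \<open>v\<close> and has the transform
  \<open>(m / (m + \<theta> powr \<alpha>)) ^ m\<close>.

  Two things remain.  The scalar \<open>Y\<close> has to exist: for \<open>\<alpha> = 1\<close> it is a Gamma variable \<open>G\<close>, and for
  \<open>\<alpha> < 1\<close> it is \<open>G powr (1/\<alpha>) * S\<close> with an independent positive \<open>\<alpha>\<close>-stable variable \<open>S\<close> (lemma
  \<open>has_laplace_transform_gamma_stable\<close>).  The stable law is a limit of rescaled sums of independent
  Sibuya variables, whose probability weights are read off the binomial series of
  \<open>1 - (1 - z) powr \<alpha>\<close>.  And the effect of \<open>Y\<close> has to disappear.  After taking the powers \<open>1/\<nu> j\<close>,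
  and replacing \<open>v j\<close> by \<open>v j powr \<nu> j\<close> beforehand, the \<open>j\<close>-th coordinate of a point \<open>v\<close> is multiplied
  by \<open>Y powr (1/\<nu> j)\<close>, so this factor should converge to \<open>1\<close> in probability.

  \<^item> For the whole class, \<open>\<alpha> = 1\<close>, \<open>\<nu> = 1\<close> and \<open>m \<rightarrow> \<infinity>\<close>: the Gamma variable satisfies a law of large
    numbers (lemma \<open>MPH_star_weakly_dense\<close>).
  \<^item> For a fixed \<open>\<alpha>\<close>, \<open>m = 1\<close> and all \<open>\<nu> j \<rightarrow> \<infinity>\<close>: roots of higher and higher order of one positive
    variable (lemma \<open>MPH_star_power_weakly_dense_fixed_order\<close>).
  \<^item> For fixed tail indices \<open>c\<close>, \<open>m \<rightarrow> \<infinity>\<close> and \<open>\<alpha> \<rightarrow> 1\<close> from below, so that the exponents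
    \<open>1/\<nu> j = \<alpha> / c j\<close> stay bounded and \<open>Y\<close> itself tends to \<open>1\<close> (lemma
    \<open>MPH_star_power_weakly_dense_fixed_tail\<close>).

  In the first and third case the transforms of \<open>Y\<close> converge to \<open>exp (- \<theta>)\<close>; two values of them
  control the second moment of \<open>exp (- Y) - exp (- 1)\<close>, and that already gives \<open>Y \<rightarrow> 1\<close> in
  probability.
\<close>

text \<open>
  The theory of determinants brings back the notation for matrix entries and the scalar product of
  vectors with varying dimension; \<open>$\<close> and \<open>\<bullet>\<close> shall refer to \<open>real^'n\<close>.
\<close>
no_notation Matrix.vec_index (infixl \<open>$\<close> 100)
no_notation Matrix.scalar_prod (infix \<open>\<bullet>\<close> 70)

section \<open>Parallel Erlang chains\<close>

text \<open>
  Gauss--Jordan elimination succeeds on every unit of the matrix ring, and an upper triangular matrix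
  with nonzero diagonal has nonzero determinant.
\<close>
lemma mat_inverse_upper_triangular:
  fixes A :: "real mat"
  assumes A: "A \<in> carrier_mat p p" and ut: "upper_triangular A"
    and diag: "\<And>i. i < p \<Longrightarrow> A $$ (i, i) \<noteq> 0"
  obtains B where "mat_inverse A = Some B" "B \<in> carrier_mat p p" "A * B = 1\<^sub>m p" "B * A = 1\<^sub>m p"
proof -
  have "0 \<notin> set (diag_mat A)"
    using A diag by (auto simp: diag_mat_def)
  then have "Determinant.det A \<noteq> 0"
    using det_upper_triangular[OF ut A] by (simp add: prod_list_zero_iff)
  then have "A \<in> Units (ring_mat TYPE(real) p ())"
    by (rule det_non_zero_imp_unit[OF A])
  then obtain B where "mat_inverse A = Some B"
    using mat_inverse(1)[OF A, of "()"] by (cases "mat_inverse A") auto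
  with mat_inverse(2)[OF A this] that show ?thesis by blast
qed

text \<open>
  State \<open>l * m + r\<close> is phase \<open>r < m\<close> of chain \<open>l\<close>.  The condition \<open>j mod m \<noteq> 0\<close> cuts the transition from
  the last phase of one chain to the first phase of the next, so the last phase exits instead.
\<close>
definition erlang_generator :: "nat \<Rightarrow> nat \<Rightarrow> real mat" where
  "erlang_generator K m = mat (K * m) (K * m)
     (\<lambda>(i, j). if j = i then - real m else if j = Suc i \<and> j mod m \<noteq> 0 then real m else 0)"

definition erlang_initial :: "nat \<Rightarrow> nat \<Rightarrow> (nat \<Rightarrow> real) \<Rightarrow> real vec" where
  "erlang_initial K m w = vec (K * m) (\<lambda>i. if i mod m = 0 then w (i div m) else 0)"

lemma erlang_generator_carrier [simp]:
  "erlang_generator K m \<in> carrier_mat (K * m) (K * m)"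
  "dim_row (erlang_generator K m) = K * m" "dim_col (erlang_generator K m) = K * m"
  by (simp_all add: erlang_generator_def)

lemma erlang_generator_row_sum:
  assumes i: "i < K * m"
  shows "(\<Sum>j<K * m. erlang_generator K m $$ (i, j) * x j) =
     - real m * x i + (if Suc i mod m \<noteq> 0 then real m * x (Suc i) else 0)"
proof -
  \<comment> \<open>In the last row \<open>Suc i\<close> is a multiple of \<open>m\<close>, so a transition never leaves the index range.\<close>
  have bound: "Suc i < K * m" if "Suc i mod m \<noteq> 0"
    using that i by (cases "Suc i = K * m") auto
  have "(\<Sum>j<K * m. erlang_generator K m $$ (i, j) * x j) =
    (\<Sum>j<K * m. (if j = i then - real m * x i else 0) +
       (if j = Suc i then if Suc i mod m \<noteq> 0 then real m * x (Suc i) else 0 else 0))"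
    using i by (intro sum.cong) (auto simp: erlang_generator_def)
  also have "\<dots> = - real m * x i + (if Suc i mod m \<noteq> 0 then real m * x (Suc i) else 0)"
    using i bound by (auto simp: sum.distrib)
  finally show ?thesis .
qed

lemma exit_vec_erlang_generator:
  "exit_vec (erlang_generator K m) \<in> carrier_vec (K * m)"
  "i < K * m \<Longrightarrow> exit_vec (erlang_generator K m) $v i = (if Suc i mod m = 0 then real m else 0)"
proof -
  show "exit_vec (erlang_generator K m) \<in> carrier_vec (K * m)"
    by (intro carrier_vecI) (simp add: exit_vec_def)
  assume i: "i < K * m"
  have "exit_vec (erlang_generator K m) $v i = - (\<Sum>j<K * m. erlang_generator K m $$ (i, j) * 1)"
    using i by (simp add: exit_vec_def ones_vec_def mult_mat_vec_def Matrix.scalar_prod_def lessThan_atLeast0)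
  also have "\<dots> = (if Suc i mod m = 0 then real m else 0)"
    using erlang_generator_row_sum[OF i, where x = "\<lambda>_. 1"] by auto
  finally show "exit_vec (erlang_generator K m) $v i = (if Suc i mod m = 0 then real m else 0)" .
qed

lemma erlang_generator_shift_inverse:
  assumes m: "1 \<le> m" and d: "\<And>i. 0 \<le> d i"
  shows "\<exists>B. mat_inverse (mat_diag (K * m) d - erlang_generator K m) = Some B \<and>
    B \<in> carrier_mat (K * m) (K * m) \<and> B * (mat_diag (K * m) d - erlang_generator K m) = 1\<^sub>m (K * m)"
proof -
  let ?A = "mat_diag (K * m) d - erlang_generator K m"
  have "?A \<in> carrier_mat (K * m) (K * m)"
    by (intro minus_carrier_mat) simp
  moreover have "upper_triangular ?A"
    by (auto simp: upper_triangular_def erlang_generator_def mat_diag_def)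
  moreover have "?A $$ (i, i) \<noteq> 0" if "i < K * m" for i
    using d[of i] m that by (simp add: erlang_generator_def mat_diag_def)
  ultimately obtain B where "mat_inverse ?A = Some B" "B \<in> carrier_mat (K * m) (K * m)" "B * ?A = 1\<^sub>m (K * m)"
    by (rule mat_inverse_upper_triangular)
  then show ?thesis by auto
qed

lemma invertible_erlang_generator:
  assumes m: "1 \<le> m"
  shows "invertible_mat (erlang_generator K m)"
proof -
  let ?T = "erlang_generator K m"
  obtain B where B: "B \<in> carrier_mat (K * m) (K * m)"
    "?T * B = 1\<^sub>m (K * m)" "B * ?T = 1\<^sub>m (K * m)"
  proof (rule mat_inverse_upper_triangular[of ?T "K * m"])
    show "upper_triangular ?T"
      by (auto simp: upper_triangular_def erlang_generator_def)
    show "?T $$ (i, i) \<noteq> 0" if "i < K * m" for i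
      using that m by (simp add: erlang_generator_def)
  qed auto
  then show ?thesis
    by (auto simp: invertible_mat_def inverts_mat_def)
qed

lemma sum_block_starts:
  fixes g :: "nat \<Rightarrow> real"
  assumes "1 \<le> m"
  shows "(\<Sum>i<K * m. (if i mod m = 0 then g (i div m) else 0)) = (\<Sum>l<K. g l)"
proof -
  have "(\<Sum>i<K * m. (if i mod m = 0 then g (i div m) else 0)) = (\<Sum>i\<in>(\<lambda>l. l * m) ` {..<K}. g (i div m))"
    using assms by (intro sum.mono_neutral_cong_right) (auto simp: div_less_iff_less_mult intro!: image_eqI[where x="_ div m"])
  also have "\<dots> = (\<Sum>l<K. g l)"
    using assms by (subst sum.reindex) (auto simp: inj_on_def)
  finally show ?thesis .
qed

lemma admissible_erlang:
  fixes v :: "nat \<Rightarrow> real^'n"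
  assumes "1 \<le> K" "1 \<le> m" "\<And>l. l < K \<Longrightarrow> 0 \<le> w l" "(\<Sum>l<K. w l) = 1" "\<And>l j. l < K \<Longrightarrow> 0 \<le> v l $ j"
  shows "admissible (K * m) (erlang_initial K m w) (erlang_generator K m) (\<lambda>i. v (i div m))"
proof -
  have "(\<Sum>i<K * m. erlang_initial K m w $v i) = (\<Sum>i<K * m. if i mod m = 0 then w (i div m) else 0)"
    by (intro sum.cong) (auto simp: erlang_initial_def)
  then have "(\<Sum>i<K * m. erlang_initial K m w $v i) = 1"
    using assms by (simp add: sum_block_starts)
  moreover have "i div m < K" if "i < K * m" for i
    using that by (simp add: less_mult_imp_div_less)
  ultimately show ?thesis
    using assms invertible_erlang_generator[of m K]
    by (auto simp: admissible_def probability_vector_def transient_subintensity_matrix_def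
        exit_vec_erlang_generator erlang_initial_def)
      (simp_all add: erlang_generator_def)
qed

lemma mod_Suc_block:
  assumes m: "1 \<le> (m::nat)"
  shows "Suc i mod m = 0 \<Longrightarrow> m - i mod m = 1"
    and "Suc i mod m \<noteq> 0 \<Longrightarrow> m - i mod m = Suc (m - Suc i mod m)"
    and "Suc i mod m \<noteq> 0 \<Longrightarrow> Suc i div m = i div m"
proof -
  have less: "i mod m < m" using m by simp
  show "m - i mod m = 1" if "Suc i mod m = 0"
  proof -
    have "Suc (i mod m) = m" using that unfolding mod_Suc by (rule contrapos_pp) simp
    then show ?thesis by linarith
  qed
  assume S: "Suc i mod m \<noteq> 0"
  then have "Suc i mod m = Suc (i mod m)" unfolding mod_Suc by presburger
  then show "m - i mod m = Suc (m - Suc i mod m)" using less by linarith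
  show "Suc i div m = i div m" using S unfolding div_Suc by simp
qed

text \<open>
  The vector obtained by applying the inverse to the exit rates need not be computed, only checked: in
  phase \<open>r\<close> of a chain with \<open>d = (v l \<bullet> \<theta>) powr \<alpha>\<close> its entry is \<open>(m / (m + d)) ^ (m - r)\<close>, one factor
  \<open>m / (m + d)\<close> for each phase still to be passed.
\<close>
lemma mph_laplace_erlang:
  fixes v :: "nat \<Rightarrow> real^'n"
  assumes m: "1 \<le> m"
  shows "mph_laplace \<alpha> (erlang_initial K m w) (erlang_generator K m) (\<lambda>i. v (i div m)) \<theta> =
    (\<Sum>l<K. w l * (real m / (real m + (v l \<bullet> \<theta>) powr \<alpha>)) ^ m)"
proof -
  let ?T = "erlang_generator K m"
  define p where "p = K * m"
  define d where "d i = (v (i div m) \<bullet> \<theta>) powr \<alpha>" for i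
  define r where "r i = real m / (real m + d i)" for i
  define x where "x i = r i ^ (m - i mod m)" for i
  define A where "A = mat_diag p d - ?T"
  have A: "A \<in> carrier_mat p p"
    unfolding A_def p_def by (intro minus_carrier_mat) simp
  have d0: "0 \<le> d i" for i by (simp add: d_def)
  have "\<exists>B. mat_inverse A = Some B \<and> B \<in> carrier_mat p p \<and> B * A = 1\<^sub>m p"
    unfolding A_def p_def by (rule erlang_generator_shift_inverse[OF m d0])
  then obtain B where B: "mat_inverse A = Some B" "B \<in> carrier_mat p p" "B * A = 1\<^sub>m p"
    by blast
  have "A *\<^sub>v vec p x = exit_vec ?T"
  proof (rule eq_vecI)
    fix i assume "i < dim_vec (exit_vec ?T)"
    then have i: "i < K * m" using carrier_vecD[OF exit_vec_erlang_generator(1)[of K m]] by simp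
    have "(A *\<^sub>v vec p x) $v i = (\<Sum>j<p. A $$ (i, j) * x j)"
      using i A by (simp add: p_def Matrix.scalar_prod_def lessThan_atLeast0)
    also have "\<dots> = (\<Sum>j<p. (if j = i then d i * x i else 0) - ?T $$ (i, j) * x j)"
      using i by (intro sum.cong) (auto simp: A_def p_def mat_diag_def algebra_simps)
    also have "\<dots> = d i * x i + real m * x i - (if Suc i mod m \<noteq> 0 then real m * x (Suc i) else 0)"
      using i by (simp add: sum_subtractf p_def erlang_generator_row_sum)
    also have "\<dots> = (if Suc i mod m = 0 then real m else 0)"
    proof -
      have r: "(d i + real m) * r i = real m"
        using d0[of i] m by (simp add: r_def field_simps)
      show ?thesis
      proof (cases "Suc i mod m = 0")
        case True
        then have "x i = r i"
          using mod_Suc_block(1)[OF m True] by (simp add: x_def)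
        then show ?thesis using True r by (simp add: distrib_right)
      next
        case False
        have "x i = r i * x (Suc i)"
          unfolding x_def mod_Suc_block(2)[OF m False] r_def d_def mod_Suc_block(3)[OF m False]
          by (rule power_Suc)
        then have "d i * x i + real m * x i = (d i + real m) * r i * x (Suc i)"
          by (simp add: algebra_simps)
        then show ?thesis using False r by simp
      qed
    qed
    also have "\<dots> = exit_vec ?T $v i"
      using exit_vec_erlang_generator(2)[OF i] by simp
    finally show "(A *\<^sub>v vec p x) $v i = exit_vec ?T $v i" .
  qed (use A carrier_vecD[OF exit_vec_erlang_generator(1)[of K m]] in \<open>simp add: p_def\<close>)
  then have "B *\<^sub>v exit_vec ?T = (B * A) *\<^sub>v vec p x"
    using A B by (metis assoc_mult_mat_vec vec_carrier)
  then have sol: "B *\<^sub>v exit_vec ?T = vec p x" using B by simp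
  have "mph_laplace \<alpha> (erlang_initial K m w) ?T (\<lambda>i. v (i div m)) \<theta> = erlang_initial K m w \<bullet>v vec p x"
    using B(1) sol by (simp add: mph_laplace_def A_def p_def d_def[abs_def])
  also have "\<dots> = (\<Sum>i<K * m. (if i mod m = 0 then w (i div m) * r (i div m * m) ^ m else 0))"
    unfolding Matrix.scalar_prod_def p_def
    by (auto simp: erlang_initial_def x_def lessThan_atLeast0 intro!: sum.cong)
  also have "\<dots> = (\<Sum>l<K. w l * r (l * m) ^ m)"
    by (rule sum_block_starts[OF m])
  finally show ?thesis using m by (simp add: r_def d_def)
qed

section \<open>Laplace transforms of distributions on the half-line\<close>

definition has_laplace_transform :: "real measure \<Rightarrow> (real \<Rightarrow> real) \<Rightarrow> bool" where
  "has_laplace_transform \<mu> \<phi> \<longleftrightarrow>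
     real_distribution \<mu> \<and> (AE y in \<mu>. 0 \<le> y) \<and> (\<forall>\<theta>\<ge>0. (\<integral>y. exp (- (\<theta> * y)) \<partial>\<mu>) = \<phi> \<theta>)"

lemma has_laplace_transformD:
  "has_laplace_transform \<mu> \<phi> \<Longrightarrow> 0 \<le> \<theta> \<Longrightarrow> (\<integral>y. exp (- (\<theta> * y)) \<partial>\<mu>) = \<phi> \<theta>"
  by (simp add: has_laplace_transform_def)

lemma has_laplace_transform_integrable:
  assumes "has_laplace_transform \<mu> \<phi>" "0 \<le> \<theta>"
  shows "integrable \<mu> (\<lambda>y. exp (- (\<theta> * y)))"
proof -
  interpret real_distribution \<mu> using assms by (simp add: has_laplace_transform_def)
  have "AE y in \<mu>. norm (exp (- (\<theta> * y))) \<le> 1"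
    using assms by (auto simp: has_laplace_transform_def)
  then show ?thesis by (intro integrable_const_bound[where B = 1]) simp_all
qed

lemma has_laplace_transform_mult:
  assumes \<mu>: "has_laplace_transform \<mu> \<phi>" and \<nu>: "has_laplace_transform \<nu> \<psi>"
  shows "has_laplace_transform (distr (\<mu> \<Otimes>\<^sub>M \<nu>) borel (\<lambda>(x, y). x + y)) (\<lambda>\<theta>. \<phi> \<theta> * \<psi> \<theta>)"
proof -
  interpret \<mu>: real_distribution \<mu> using \<mu> by (simp add: has_laplace_transform_def)
  interpret \<nu>: real_distribution \<nu> using \<nu> by (simp add: has_laplace_transform_def)
  interpret pair_prob_space \<mu> \<nu> ..
  have "AE x in \<mu>. AE y in \<nu>. 0 \<le> x + y"
    using \<mu> \<nu> unfolding has_laplace_transform_def by auto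
  moreover have "{p \<in> space (\<mu> \<Otimes>\<^sub>M \<nu>). 0 \<le> fst p + snd p} \<in> sets (\<mu> \<Otimes>\<^sub>M \<nu>)"
    by measurable
  ultimately have pos: "AE p in \<mu> \<Otimes>\<^sub>M \<nu>. 0 \<le> fst p + snd p"
    by (intro AE_pair_measure) (simp_all only: fst_conv snd_conv)
  moreover have "(\<integral>x. exp (- (\<theta> * x)) \<partial>distr (\<mu> \<Otimes>\<^sub>M \<nu>) borel (\<lambda>(x, y). x + y)) = \<phi> \<theta> * \<psi> \<theta>"
    if \<theta>: "0 \<le> \<theta>" for \<theta>
  proof -
    have "(\<integral>x. exp (- (\<theta> * x)) \<partial>distr (\<mu> \<Otimes>\<^sub>M \<nu>) borel (\<lambda>(x, y). x + y)) =
        (\<integral>p. exp (- (\<theta> * fst p)) * exp (- (\<theta> * snd p)) \<partial>(\<mu> \<Otimes>\<^sub>M \<nu>))"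
      by (subst integral_distr) (auto simp: case_prod_beta algebra_simps simp flip: exp_add)
    also have "\<dots> = (\<integral>x. \<integral>y. exp (- (\<theta> * x)) * exp (- (\<theta> * y)) \<partial>\<nu> \<partial>\<mu>)"
    proof -
      have "integrable (\<mu> \<Otimes>\<^sub>M \<nu>) (\<lambda>p. exp (- (\<theta> * fst p)) * exp (- (\<theta> * snd p)))"
      proof (rule P.integrable_const_bound[where B = 1])
        show "AE p in \<mu> \<Otimes>\<^sub>M \<nu>. norm (exp (- (\<theta> * fst p)) * exp (- (\<theta> * snd p))) \<le> 1"
          using pos
        proof eventually_elim
          case (elim p)
          then show ?case
            using mult_nonneg_nonneg[OF \<theta> elim] by (simp add: distrib_left flip: exp_add)
        qed
      qed simp
      from integral_fst'[OF this] show ?thesis by simp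
    qed
    also have "\<dots> = \<phi> \<theta> * \<psi> \<theta>"
      using \<mu> \<nu> \<theta> by (simp add: has_laplace_transform_def)
    finally show ?thesis .
  qed
  ultimately show ?thesis
    unfolding has_laplace_transform_def real_distribution_def real_distribution_axioms_def
    by (auto simp: AE_distr_iff case_prod_beta intro!: prob_space_distr)
qed

lemma has_laplace_transform_scale:
  assumes \<mu>: "has_laplace_transform \<mu> \<phi>" and c: "0 \<le> c"
  shows "has_laplace_transform (distr \<mu> borel (\<lambda>y. c * y)) (\<lambda>\<theta>. \<phi> (c * \<theta>))"
proof -
  interpret \<mu>: real_distribution \<mu> using \<mu> by (simp add: has_laplace_transform_def)
  have "AE y in \<mu>. 0 \<le> c * y"
    using \<mu> c unfolding has_laplace_transform_def by auto
  moreover have "(\<integral>y. exp (- (\<theta> * y)) \<partial>distr \<mu> borel (\<lambda>y. c * y)) = \<phi> (c * \<theta>)" if "0 \<le> \<theta>" for \<theta>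
  proof -
    have "(\<integral>y. exp (- (\<theta> * y)) \<partial>distr \<mu> borel (\<lambda>y. c * y)) = (\<integral>y. exp (- ((c * \<theta>) * y)) \<partial>\<mu>)"
      by (subst integral_distr) (auto simp: mult_ac)
    then show ?thesis using \<mu> c that by (simp add: has_laplace_transform_def)
  qed
  ultimately show ?thesis
    unfolding has_laplace_transform_def real_distribution_def real_distribution_axioms_def
    by (auto simp: AE_distr_iff intro!: \<mu>.prob_space_distr)
qed

lemma has_laplace_transform_power:
  assumes "has_laplace_transform \<mu> \<phi>"
  shows "\<exists>\<nu>. has_laplace_transform \<nu> (\<lambda>\<theta>. \<phi> \<theta> ^ n)"
proof (induction n)
  case 0
  have "has_laplace_transform (return borel 0) (\<lambda>_. 1)"
    unfolding has_laplace_transform_def real_distribution_def real_distribution_axioms_def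
    by (auto simp: prob_space_return AE_return integral_return)
  then show ?case by auto
next
  case (Suc n)
  then show ?case using has_laplace_transform_mult[OF assms] by auto
qed

text \<open>
  A continuity theorem.  The lower bound \<open>b\<close>, uniform in \<open>n\<close> and tending to \<open>1\<close> at \<open>0\<close>, gives tightness,
  because \<open>1 - \<phi> n \<theta>\<close> is at least \<open>1 - exp (- 1)\<close> times the mass of \<open>{1 / \<theta> <..}\<close>.  Helly's theorem then
  provides a weakly convergent subsequence, and its limit has the transform \<open>\<psi>\<close> since
  \<open>y \<mapsto> exp (- \<theta> y)\<close> is bounded and continuous on the half-line.
\<close>
lemma has_laplace_transform_limit:
  fixes \<mu> :: "nat \<Rightarrow> real measure"
  assumes \<mu>: "\<And>n. has_laplace_transform (\<mu> n) (\<phi> n)"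
    and lim: "\<And>\<theta>. 0 \<le> \<theta> \<Longrightarrow> (\<lambda>n. \<phi> n \<theta>) \<longlonglongrightarrow> \<psi> \<theta>"
    and bound: "\<And>n \<theta>. 0 < \<theta> \<Longrightarrow> b \<theta> \<le> \<phi> n \<theta>"
    and b: "(b \<longlongrightarrow> 1) (at_right 0)"
  shows "\<exists>\<nu>. has_laplace_transform \<nu> \<psi>"
proof -
  have dist: "real_distribution (\<mu> n)" for n using \<mu> by (simp add: has_laplace_transform_def)
  have nonneg: "AE y in \<mu> n. 0 \<le> y" for n using \<mu> by (simp add: has_laplace_transform_def)
  have "\<exists>a c. a < c \<and> (\<forall>n. 1 - \<epsilon> < measure (\<mu> n) {a<..c})" if "0 < \<epsilon>" for \<epsilon> :: real
  proof -
    define \<delta> where "\<delta> = \<epsilon> * (1 - exp (- 1 :: real))"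
    have \<delta>: "0 < \<delta>" using that by (simp add: \<delta>_def)
    have "eventually (\<lambda>\<theta>. 1 - \<delta> < b \<theta> \<and> 0 < \<theta>) (at_right 0)"
      using order_tendstoD(1)[OF b, of "1 - \<delta>"] \<delta> eventually_at_right_less[of 0]
      by (auto intro: eventually_conj)
    then obtain \<theta> where \<theta>: "1 - \<delta> < b \<theta>" "0 < \<theta>"
      using eventually_happens' trivial_limit_at_right_real by blast
    \<comment> \<open>Tightness is phrased with intervals open on the left; \<open>-1\<close> only keeps \<open>0\<close> inside.\<close>
    have "1 - \<epsilon> < measure (\<mu> n) {-1<..1 / \<theta>}" for n
    proof -
      interpret real_distribution "\<mu> n" by (rule dist)
      let ?A = "{1 / \<theta><..}"
      have "(1 - exp (- 1)) * prob ?A = (\<integral>y. (1 - exp (- 1)) * indicator ?A y \<partial>\<mu> n)"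
        by simp
      also have "\<dots> \<le> (\<integral>y. 1 - exp (- (\<theta> * y)) \<partial>\<mu> n)"
      proof (rule integral_mono_AE)
        show "AE y in \<mu> n. (1 - exp (- 1)) * indicator ?A y \<le> 1 - exp (- (\<theta> * y))"
          using nonneg[of n]
        proof eventually_elim
          case (elim y)
          then show ?case using \<theta> by (auto simp: indicator_def field_simps)
        qed
      qed (use has_laplace_transform_integrable[OF \<mu>[of n], of \<theta>] \<theta> in
          \<open>auto intro!: integrable_real_indicator simp: emeasure_eq_measure\<close>)
      also have "\<dots> = 1 - \<phi> n \<theta>"
        using has_laplace_transform_integrable[OF \<mu>[of n]] \<theta> \<mu>[of n] prob_space
        by (simp add: has_laplace_transform_def)
      also have "\<dots> < \<delta>" using bound[of \<theta> n] \<theta> by simp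
      finally have "prob ?A < \<epsilon>" unfolding \<delta>_def by (simp add: mult.commute)
      moreover have "prob {-1<..1 / \<theta>} = prob (UNIV - ?A)"
        using nonneg[of n] by (intro finite_measure_eq_AE) (auto elim!: eventually_mono)
      moreover have "prob (UNIV - ?A) = 1 - prob ?A"
        using prob_compl[of ?A] by simp
      ultimately show ?thesis by simp
    qed
    moreover have "-1 < 1 / \<theta>" using \<theta> by (simp add: less_trans[of _ 0])
    ultimately show ?thesis by blast
  qed
  then have "tight \<mu>" unfolding tight_def using dist by auto
  then obtain r \<nu> where r: "strict_mono (r :: nat \<Rightarrow> nat)" and \<nu>: "real_distribution \<nu>"
    and conv: "weak_conv_m (\<mu> \<circ> id \<circ> r) \<nu>"
    using tight_imp_convergent_subsubsequence[of \<mu> id] by (auto simp: strict_mono_def)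
  interpret \<nu>: real_distribution \<nu> by (rule \<nu>)
  have trans: "(\<lambda>n. \<integral>y. f y \<partial>\<mu> (r n)) \<longlonglongrightarrow> (\<integral>y. f y \<partial>\<nu>)"
    if "\<And>x. isCont f x" "\<And>x. norm (f x) \<le> 1" for f :: "real \<Rightarrow> real"
    using weak_conv_imp_integral_bdd_continuous_conv[of "\<mu> \<circ> id \<circ> r" \<nu> f 1] dist \<nu> conv that
    by simp
  have AE: "AE y in \<nu>. 0 \<le> y"
  proof -
    \<comment> \<open>A bounded continuous function that vanishes exactly on the half-line.\<close>
    define f where "f y = max 0 (min 1 (- y))" for y :: real
    have f: "isCont f x" "norm (f x) \<le> 1" for x
      by (auto simp: f_def[abs_def] intro!: continuous_max continuous_min continuous_intros)
    have [measurable]: "f \<in> borel_measurable borel" unfolding f_def by measurable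
    have "(\<integral>y. f y \<partial>\<mu> n) = 0" for n
      by (rule integral_eq_zero_AE) (use nonneg[of n] in \<open>auto simp: f_def elim!: eventually_mono\<close>)
    then have "(\<integral>y. f y \<partial>\<nu>) = 0" using trans[of f, OF f] by (simp add: LIMSEQ_const_iff)
    moreover have "integrable \<nu> f" using f by (intro \<nu>.integrable_const_bound[where B = 1]) auto
    ultimately have "AE y in \<nu>. f y = 0"
      by (subst (asm) integral_nonneg_eq_0_iff_AE) (auto simp: f_def)
    then show ?thesis by eventually_elim (auto simp: f_def max_def min_def split: if_splits)
  qed
  moreover have "(\<integral>y. exp (- (\<theta> * y)) \<partial>\<nu>) = \<psi> \<theta>" if \<theta>: "0 \<le> \<theta>" for \<theta>
  proof -
    \<comment> \<open>The exponential may be unbounded on the negative axis, where it is replaced by \<open>1\<close>.\<close>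
    define f where "f y = exp (- (\<theta> * max 0 y))" for y :: real
    have f: "isCont f x" "norm (f x) \<le> 1" for x
      using \<theta> by (auto simp: f_def[abs_def] intro!: continuous_max continuous_intros)
    have [measurable]: "f \<in> borel_measurable borel" unfolding f_def by measurable
    have cong: "(\<integral>y. f y \<partial>M) = (\<integral>y. exp (- (\<theta> * y)) \<partial>M)" if "AE y in M. 0 \<le> y" "sets M = sets borel" for M
      using that by (intro integral_cong_AE) (auto simp: f_def max_def elim!: eventually_mono)
    have "(\<integral>y. f y \<partial>\<mu> n) = \<phi> n \<theta>" for n
      using cong[OF nonneg[of n]] \<mu>[of n] \<theta> dist[of n]
      by (simp add: has_laplace_transform_def real_distribution_def real_distribution_axioms_def)
    then have "(\<lambda>n. \<phi> (r n) \<theta>) \<longlonglongrightarrow> (\<integral>y. exp (- (\<theta> * y)) \<partial>\<nu>)"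
      using trans[of f, OF f] cong[OF AE] by simp
    moreover have "(\<lambda>n. \<phi> (r n) \<theta>) \<longlonglongrightarrow> \<psi> \<theta>"
      using LIMSEQ_subseq_LIMSEQ[OF lim[OF \<theta>] r] by (simp add: o_def)
    ultimately show ?thesis by (rule LIMSEQ_unique)
  qed
  ultimately show ?thesis using \<nu> by (auto simp: has_laplace_transform_def)
qed

section \<open>Stable laws and their Gamma mixtures\<close>

text \<open>
  Multiplying the density by \<open>exp (- \<theta> x)\<close> turns it into a multiple of the Erlang density with rate
  \<open>l + \<theta>\<close>, and the factor is the transform.
\<close>
lemma has_laplace_transform_gamma:
  assumes l: "0 < l"
  shows "has_laplace_transform (density lborel (erlang_density k l)) (\<lambda>\<theta>. (l / (l + \<theta>)) ^ Suc k)"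
  unfolding has_laplace_transform_def
proof (intro conjI allI impI)
  have unit: "(\<integral>x. erlang_density k c x \<partial>lborel) = 1" if "0 < c" for c :: real
  proof -
    interpret prob_space "density lborel (erlang_density k c)"
      by (rule prob_space_erlang_density[OF that])
    have "(\<integral>x. 1 \<partial>density lborel (erlang_density k c)) = (\<integral>x. erlang_density k c x * (1::real) \<partial>lborel)"
      using that by (subst integral_density) auto
    then show ?thesis using prob_space by simp
  qed
  interpret prob_space "density lborel (erlang_density k l)"
    by (rule prob_space_erlang_density[OF l])
  show "real_distribution (density lborel (erlang_density k l))"
    by unfold_locales simp
  show "AE y in density lborel (erlang_density k l). 0 \<le> y"
    by (subst AE_density) (auto simp: erlang_density_def)
  fix \<theta> :: real assume \<theta>: "0 \<le> \<theta>"
  have "(\<integral>y. exp (- (\<theta> * y)) \<partial>density lborel (erlang_density k l)) =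
      (\<integral>y. erlang_density k l y * exp (- (\<theta> * y)) \<partial>lborel)"
    using l by (subst integral_density) auto
  also have "\<dots> = (\<integral>y. (l / (l + \<theta>)) ^ Suc k * erlang_density k (l + \<theta>) y \<partial>lborel)"
  proof (rule Bochner_Integration.integral_cong[OF refl])
    fix y
    have "exp (- l * y) * exp (- (\<theta> * y)) = exp (- (l + \<theta>) * y)"
      by (simp add: exp_add[symmetric] algebra_simps)
    then have "erlang_density k l y * exp (- (\<theta> * y)) =
        (if y < 0 then 0 else l ^ Suc k * y ^ k * exp (- (l + \<theta>) * y) / fact k)"
      unfolding erlang_density_def by (simp add: mult.assoc)
    also have "\<dots> = (l / (l + \<theta>)) ^ Suc k * erlang_density k (l + \<theta>) y"
    proof -
      have "l ^ Suc k = (l / (l + \<theta>)) ^ Suc k * (l + \<theta>) ^ Suc k"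
        unfolding power_mult_distrib[symmetric] using l \<theta> by simp
      then show ?thesis unfolding erlang_density_def by simp
    qed
    finally show "erlang_density k l y * exp (- (\<theta> * y)) = \<dots>" .
  qed
  also have "\<dots> = (l / (l + \<theta>)) ^ Suc k"
    using unit[of "l + \<theta>"] l \<theta> by simp
  finally show "(\<integral>y. exp (- (\<theta> * y)) \<partial>density lborel (erlang_density k l)) = (l / (l + \<theta>)) ^ Suc k" .
qed

lemma has_laplace_transform_power_series:
  assumes nonneg: "\<And>k. 0 \<le> c k" and sums: "c sums 1"
  shows "\<exists>\<mu>. has_laplace_transform \<mu> (\<lambda>\<theta>. \<Sum>k. c k * exp (- \<theta>) ^ k)"
proof -
  define D where "D = density (count_space UNIV) (\<lambda>k::nat. ennreal (c k))"
  have sets_D [measurable_cong]: "sets D = sets (count_space UNIV)" by (simp add: D_def)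
  have "emeasure D (space D) = (\<Sum>k. ennreal (c k))"
    by (simp add: D_def emeasure_density nn_integral_count_space_nat)
  also have "\<dots> = 1"
    using sums nonneg by (simp add: suminf_ennreal2 sums_iff)
  finally interpret D: prob_space D by (rule prob_spaceI)
  have int: "(\<integral>y. exp (- (\<theta> * y)) \<partial>distr D borel real) = (\<Sum>k. c k * exp (- \<theta>) ^ k)" if "0 \<le> \<theta>" for \<theta>
  proof -
    have "summable (\<lambda>k. norm (c k * exp (- (\<theta> * real k))))"
    proof (rule summable_comparison_test')
      show "summable c" using sums by (simp add: sums_iff)
      show "norm (norm (c k * exp (- (\<theta> * real k)))) \<le> c k" for k
        using nonneg[of k] that by (auto simp: abs_mult intro!: mult_left_le)
    qed
    then have "integrable (count_space UNIV) (\<lambda>k. c k * exp (- (\<theta> * real k)))"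
      by (simp add: integrable_count_space_nat_iff)
    then have "(\<integral>k. c k * exp (- (\<theta> * real k)) \<partial>count_space UNIV) = (\<Sum>k. c k * exp (- (\<theta> * real k)))"
      by (rule integral_count_space_nat)
    moreover have "exp (- (\<theta> * real k)) = exp (- \<theta>) ^ k" for k
      by (simp add: exp_of_nat_mult[symmetric] mult.commute)
    moreover have "(\<integral>y. exp (- (\<theta> * y)) \<partial>distr D borel real) = (\<integral>k. c k * exp (- (\<theta> * real k)) \<partial>count_space UNIV)"
      unfolding D_def using nonneg by (simp add: integral_distr integral_density)
    ultimately show ?thesis by simp
  qed
  have "AE y in distr D borel real. 0 \<le> y" by (subst AE_distr_iff) auto
  then show ?thesis
    using int unfolding has_laplace_transform_def real_distribution_def real_distribution_axioms_def
    by (intro exI[of _ "distr D borel real"]) (auto intro!: D.prob_space_distr)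
qed

text \<open>
  The coefficients of \<open>1 - (1 - z) powr \<alpha>\<close> at \<open>z ^ k\<close> with \<open>k \<ge> 1\<close> are nonnegative, by the recursion
  \<open>(k + 1) * c (k + 1) = (k - \<alpha>) * c k\<close> and \<open>\<alpha> < 1\<close>.  For nonnegative coefficients the sum of the series
  at \<open>z = 1\<close> is the limit from the left, which is \<open>1\<close> here.  So they are the weights of a
  distribution, and \<open>z = exp (- \<theta>)\<close> gives its Laplace transform.
\<close>
lemma has_laplace_transform_sibuya:
  assumes \<alpha>: "0 < \<alpha>" "\<alpha> < 1"
  shows "\<exists>\<mu>. has_laplace_transform \<mu> (\<lambda>\<theta>. 1 - (1 - exp (- \<theta>)) powr \<alpha>)"
proof -
  define c where "c k = (if k = 0 then 0 else - ((- 1) ^ k * (\<alpha> gchoose k)))" for k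
  have nonneg: "0 \<le> c k" for k
  proof (induction k)
    case (Suc k)
    show ?case
    proof (cases "k = 0")
      case True
      then show ?thesis using \<alpha> by (simp add: c_def)
    next
      case False
      have "real (Suc k) * c (Suc k) = (real k - \<alpha>) * c k"
      proof -
        have "real (Suc k) * (\<alpha> gchoose Suc k) = (\<alpha> - real k) * (\<alpha> gchoose k)"
          using gbinomial_mult_1[of \<alpha> k] by (simp add: algebra_simps)
        then have "(- 1) ^ k * (real (Suc k) * (\<alpha> gchoose Suc k)) = (- 1) ^ k * ((\<alpha> - real k) * (\<alpha> gchoose k))"
          by (rule arg_cong)
        then show ?thesis using False by (simp add: c_def algebra_simps)
      qed
      moreover have "0 \<le> (real k - \<alpha>) * c k"
        using Suc False \<alpha> by (intro mult_nonneg_nonneg) auto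
      ultimately show ?thesis
        by (metis of_nat_0_less_iff zero_le_mult_iff not_less zero_less_Suc less_eq_real_def)
    qed
  qed (simp add: c_def)
  have series: "(\<lambda>k. c k * z ^ k) sums (1 - (1 - z) powr \<alpha>)" if z: "0 \<le> z" "z < 1" for z
  proof -
    have "(\<lambda>k. (\<alpha> gchoose k) * (- z) ^ k) sums (1 + - z) powr \<alpha>"
      by (rule gen_binomial_real) (use z in auto)
    then have "(\<lambda>k. (if k = 0 then 1 else 0) - (\<alpha> gchoose k) * (- z) ^ k) sums (1 - (1 + - z) powr \<alpha>)"
      by (intro sums_diff sums_If_finite_set[of "{0}" "\<lambda>_. 1", simplified]) auto
    moreover have "(if k = 0 then 1 else 0) - (\<alpha> gchoose k) * (- z) ^ k = c k * z ^ k" for k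
      by (simp add: c_def power_minus[of z])
    ultimately show ?thesis by simp
  qed
  have lim: "((\<lambda>z. 1 - (1 - z) powr \<alpha>) \<longlongrightarrow> 1) (at_left 1)"
    using \<alpha> by real_asymp
  have near: "eventually (\<lambda>z. 0 \<le> z \<and> z < 1) (at_left (1::real))"
    by (rule eventually_at_leftI[of 0]) auto
  have partial: "(\<Sum>k<n. c k) \<le> 1" for n
  proof (rule tendsto_le[OF _ lim])
    show "((\<lambda>z. \<Sum>k<n. c k * z ^ k) \<longlongrightarrow> (\<Sum>k<n. c k)) (at_left 1)"
      by (auto intro!: tendsto_eq_intros)
    show "eventually (\<lambda>z. (\<Sum>k<n. c k * z ^ k) \<le> 1 - (1 - z) powr \<alpha>) (at_left 1)"
      using near
    proof eventually_elim
      case (elim z)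
      then have "(\<Sum>k<n. c k * z ^ k) \<le> (\<Sum>k. c k * z ^ k)"
        using nonneg series[of z] by (intro sum_le_suminf) (auto simp: sums_iff)
      then show ?case using elim series[of z] by (simp add: sums_iff)
    qed
  qed simp
  then have summable: "summable c"
    using nonneg by (intro bounded_imp_summable[of c 1]) (auto simp del: sum.lessThan_Suc simp flip: lessThan_Suc_atMost)
  have "suminf c \<le> 1"
    using summable partial by (intro suminf_le_const) auto
  moreover have "1 \<le> suminf c"
  proof (rule tendsto_upperbound[OF lim])
    show "eventually (\<lambda>z. 1 - (1 - z) powr \<alpha> \<le> suminf c) (at_left 1)"
      using near
    proof eventually_elim
      case (elim z)
      then have "(\<Sum>k. c k * z ^ k) \<le> suminf c"
        using nonneg series[of z] summable
        by (intro suminf_le) (auto simp: sums_iff intro!: mult_left_le power_le_one)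
      then show ?case using elim series[of z] by (simp add: sums_iff)
    qed
  qed simp
  ultimately have "c sums 1" using summable by (simp add: sums_iff)
  then obtain \<mu> where \<mu>: "has_laplace_transform \<mu> (\<lambda>\<theta>. \<Sum>k. c k * exp (- \<theta>) ^ k)"
    using has_laplace_transform_power_series[of c] nonneg by blast
  have "(\<Sum>k. c k * exp (- \<theta>) ^ k) = 1 - (1 - exp (- \<theta>)) powr \<alpha>" if "0 \<le> \<theta>" for \<theta>
  proof (cases "\<theta> = 0")
    case True
    then show ?thesis using \<open>c sums 1\<close> by (simp add: sums_iff)
  next
    case False
    then show ?thesis using series[of "exp (- \<theta>)"] that by (simp add: sums_iff)
  qed
  then show ?thesis using \<mu> unfolding has_laplace_transform_def by auto
qed

text \<open>
  The sum of \<open>N\<close> independent Sibuya variables, multiplied by \<open>s = N powr (- 1/\<alpha>)\<close>, has the transform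
  \<open>(1 - x) ^ N\<close> with \<open>x = (1 - exp (- s * \<theta>)) powr \<alpha>\<close>, which is asymptotic to \<open>\<theta> powr \<alpha> / N\<close>.  Bernoulli's
  inequality bounds the transform from below by \<open>1 - \<theta> powr \<alpha>\<close> for all \<open>N\<close> at once.
\<close>
lemma has_laplace_transform_stable:
  assumes \<alpha>: "0 < \<alpha>" "\<alpha> < 1"
  shows "\<exists>\<mu>. has_laplace_transform \<mu> (\<lambda>\<theta>. exp (- (\<theta> powr \<alpha>)))"
proof -
  define s where "s n = real (Suc n) powr (- 1 / \<alpha>)" for n
  define \<phi> where "\<phi> n \<theta> = (1 - (1 - exp (- (s n * \<theta>))) powr \<alpha>) ^ Suc n" for n \<theta>
  have "\<exists>\<mu>. has_laplace_transform \<mu> (\<phi> n)" for n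
  proof -
    obtain \<mu> where "has_laplace_transform \<mu> (\<lambda>\<theta>. 1 - (1 - exp (- \<theta>)) powr \<alpha>)"
      using has_laplace_transform_sibuya[OF \<alpha>] by blast
    from has_laplace_transform_scale[OF this, of "s n"] show ?thesis
      unfolding \<phi>_def by (intro has_laplace_transform_power) (auto simp: s_def)
  qed
  then obtain \<mu> where \<mu>: "\<And>n. has_laplace_transform (\<mu> n) (\<phi> n)" by metis
  show ?thesis
  proof (rule has_laplace_transform_limit[OF \<mu>])
    show "(\<lambda>n. \<phi> n \<theta>) \<longlonglongrightarrow> exp (- (\<theta> powr \<alpha>))" if "0 \<le> \<theta>" for \<theta>
    proof (cases "\<theta> = 0")
      case False
      with that have "0 < \<theta>" by simp
      then show ?thesis unfolding \<phi>_def s_def using \<alpha> by real_asymp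
    qed (simp add: \<phi>_def)
    show "1 - \<theta> powr \<alpha> \<le> \<phi> n \<theta>" if \<theta>: "0 < \<theta>" for n \<theta>
    proof -
      let ?x = "(1 - exp (- (s n * \<theta>))) powr \<alpha>"
      have s: "0 < s n" by (simp add: s_def)
      have "1 - exp (- (s n * \<theta>)) \<le> s n * \<theta>"
        using exp_ge_add_one_self[of "- (s n * \<theta>)"] by simp
      then have "?x \<le> (s n * \<theta>) powr \<alpha>"
        using s \<theta> \<alpha> by (intro powr_mono2) auto
      also have "\<dots> = \<theta> powr \<alpha> / real (Suc n)"
        using \<alpha> \<theta> by (simp add: s_def powr_mult powr_divide powr_powr powr_minus_divide)
      finally have "real (Suc n) * ?x \<le> \<theta> powr \<alpha>" by (simp add: field_simps)
      moreover have "?x \<le> 1"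
        using s \<theta> \<alpha> by (intro powr_le1) auto
      then have "1 + real (Suc n) * (- ?x) \<le> (1 + - ?x) ^ Suc n"
        by (intro Bernoulli_inequality) simp
      ultimately show ?thesis by (simp add: \<phi>_def)
    qed
    show "((\<lambda>\<theta>. 1 - \<theta> powr \<alpha>) \<longlongrightarrow> 1) (at_right 0)"
      using \<alpha> by (auto intro!: tendsto_eq_intros eventually_at_rightI[of 0 1])
  qed
qed

text \<open>
  Subordination: for independent \<open>g\<close> and stable \<open>s\<close>, conditioning on \<open>g\<close> gives
  \<open>exp (- (\<theta> * g powr (1/\<alpha>)) powr \<alpha>) = exp (- (\<theta> powr \<alpha>) * g)\<close>.
\<close>
lemma has_laplace_transform_subordinate:
  assumes \<sigma>: "has_laplace_transform \<sigma> (\<lambda>\<theta>. exp (- (\<theta> powr \<alpha>)))"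
    and \<mu>: "has_laplace_transform \<mu> \<phi>" and \<alpha>: "0 < \<alpha>"
  shows "has_laplace_transform (distr (\<mu> \<Otimes>\<^sub>M \<sigma>) borel (\<lambda>(g, s). g powr (1 / \<alpha>) * s)) (\<lambda>\<theta>. \<phi> (\<theta> powr \<alpha>))"
proof -
  interpret \<mu>: real_distribution \<mu> using \<mu> by (simp add: has_laplace_transform_def)
  interpret \<sigma>: real_distribution \<sigma> using \<sigma> by (simp add: has_laplace_transform_def)
  interpret pair_prob_space \<mu> \<sigma> ..
  have "AE g in \<mu>. AE s in \<sigma>. 0 \<le> g powr (1 / \<alpha>) * s"
    using \<sigma> unfolding has_laplace_transform_def by auto
  moreover have "{p \<in> space (\<mu> \<Otimes>\<^sub>M \<sigma>). 0 \<le> fst p powr (1 / \<alpha>) * snd p} \<in> sets (\<mu> \<Otimes>\<^sub>M \<sigma>)"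
    by measurable
  ultimately have pos: "AE p in \<mu> \<Otimes>\<^sub>M \<sigma>. 0 \<le> fst p powr (1 / \<alpha>) * snd p"
    by (intro AE_pair_measure) (simp_all only: fst_conv snd_conv)
  moreover have "(\<integral>x. exp (- (\<theta> * x)) \<partial>distr (\<mu> \<Otimes>\<^sub>M \<sigma>) borel (\<lambda>(g, s). g powr (1 / \<alpha>) * s)) = \<phi> (\<theta> powr \<alpha>)"
    if \<theta>: "0 \<le> \<theta>" for \<theta>
  proof -
    have int: "integrable (\<mu> \<Otimes>\<^sub>M \<sigma>) (\<lambda>p. exp (- (\<theta> * (fst p powr (1 / \<alpha>) * snd p))))"
    proof (rule P.integrable_const_bound[where B = 1])
      show "AE p in \<mu> \<Otimes>\<^sub>M \<sigma>. norm (exp (- (\<theta> * (fst p powr (1 / \<alpha>) * snd p)))) \<le> 1"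
        using pos by eventually_elim (use \<theta> in auto)
    qed simp
    have "(\<integral>x. exp (- (\<theta> * x)) \<partial>distr (\<mu> \<Otimes>\<^sub>M \<sigma>) borel (\<lambda>(g, s). g powr (1 / \<alpha>) * s)) =
        (\<integral>p. exp (- (\<theta> * (fst p powr (1 / \<alpha>) * snd p))) \<partial>(\<mu> \<Otimes>\<^sub>M \<sigma>))"
      by (subst integral_distr) (auto simp: case_prod_beta)
    also have "\<dots> = (\<integral>g. \<integral>s. exp (- ((\<theta> * g powr (1 / \<alpha>)) * s)) \<partial>\<sigma> \<partial>\<mu>)"
      using integral_fst'[OF int] by (simp add: mult.assoc)
    also have "\<dots> = (\<integral>g. exp (- (\<theta> powr \<alpha> * g)) \<partial>\<mu>)"
    proof (rule integral_cong_AE)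
      show "AE g in \<mu>. (\<integral>s. exp (- ((\<theta> * g powr (1 / \<alpha>)) * s)) \<partial>\<sigma>) = exp (- (\<theta> powr \<alpha> * g))"
      proof -
        have "AE g in \<mu>. 0 \<le> g" using \<mu> by (simp add: has_laplace_transform_def)
        then show ?thesis
        proof eventually_elim
          case (elim g)
          have "(\<integral>s. exp (- ((\<theta> * g powr (1 / \<alpha>)) * s)) \<partial>\<sigma>) = exp (- ((\<theta> * g powr (1 / \<alpha>)) powr \<alpha>))"
            using \<sigma> \<theta> by (simp add: has_laplace_transform_def)
          then show ?case using elim \<alpha> \<theta> by (simp add: powr_mult powr_powr)
        qed
      qed
    qed simp_all
    also have "\<dots> = \<phi> (\<theta> powr \<alpha>)"
      using \<mu> by (simp add: has_laplace_transform_def)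
    finally show ?thesis .
  qed
  ultimately show ?thesis
    unfolding has_laplace_transform_def real_distribution_def real_distribution_axioms_def
    by (auto simp: AE_distr_iff case_prod_beta intro!: prob_space_distr)
qed

lemma has_laplace_transform_gamma_stable:
  assumes \<alpha>: "0 < \<alpha>" "\<alpha> \<le> 1" and m: "1 \<le> m"
  shows "\<exists>\<mu>. has_laplace_transform \<mu> (\<lambda>\<theta>. (real m / (real m + \<theta> powr \<alpha>)) ^ m)"
proof -
  obtain \<gamma> where \<gamma>: "has_laplace_transform \<gamma> (\<lambda>\<theta>. (real m / (real m + \<theta>)) ^ m)"
    using has_laplace_transform_gamma[of "real m" "m - 1"] m by auto
  show ?thesis
  proof (cases "\<alpha> = 1")
    case True
    then show ?thesis using \<gamma> unfolding has_laplace_transform_def by (intro exI[of _ \<gamma>]) simp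
  next
    case False
    then obtain \<sigma> where "has_laplace_transform \<sigma> (\<lambda>\<theta>. exp (- (\<theta> powr \<alpha>)))"
      using has_laplace_transform_stable \<alpha> by (metis less_eq_real_def)
    from has_laplace_transform_subordinate[OF this \<gamma> \<alpha>(1)] show ?thesis by blast
  qed
qed

section \<open>Concentration of the random factor at one\<close>

text \<open>
  The second moment of \<open>exp (- Y) - exp (- 1)\<close> is a combination of the transform at \<open>1\<close> and at \<open>2\<close>.  It
  tends to \<open>0\<close>, so Chebyshev's inequality shows that \<open>exp (- Y)\<close>, and hence \<open>Y\<close>, converges in probability.
\<close>
lemma has_laplace_transform_concentration:
  assumes \<mu>: "\<And>k. has_laplace_transform (\<mu> k) (\<phi> k)"
    and lim: "(\<lambda>k. \<phi> k 1) \<longlonglongrightarrow> exp (- 1)" "(\<lambda>k. \<phi> k 2) \<longlonglongrightarrow> exp (- 2)"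
    and \<delta>: "0 < \<delta>"
  shows "(\<lambda>k. measure (\<mu> k) {y. \<delta> \<le> \<bar>y - 1\<bar>}) \<longlonglongrightarrow> 0"
proof -
  \<comment> \<open>A lower bound for the distance of \<open>exp (- y)\<close> from \<open>exp (- 1)\<close> when \<open>\<delta> \<le> \<bar>y - 1\<bar>\<close>.\<close>
  define \<eta> where "\<eta> = min (exp (- 1) - exp (- 1 - \<delta>)) (exp (\<delta> - 1) - exp (- 1 :: real))"
  have \<eta>: "0 < \<eta>" using \<delta> by (simp add: \<eta>_def)
  have \<eta>_le: "\<eta> \<le> exp (- 1) - exp (- 1 - \<delta>)" "\<eta> \<le> exp (\<delta> - 1) - exp (- 1)"
    unfolding \<eta>_def by (rule min.cobounded1, rule min.cobounded2)
  have far: "\<eta> \<le> \<bar>exp (- y) - exp (- 1)\<bar>" if "\<delta> \<le> \<bar>y - 1\<bar>" for y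
  proof (cases "1 \<le> y")
    case True
    then have "exp (- y) \<le> exp (- 1 - \<delta>)" unfolding exp_le_cancel_iff using that by linarith
    then show ?thesis using \<eta>_le(1) by linarith
  next
    case False
    then have "exp (\<delta> - 1) \<le> exp (- y)" unfolding exp_le_cancel_iff using that by linarith
    then show ?thesis using \<eta>_le(2) by linarith
  qed
  define V where "V k = \<phi> k 2 - 2 * exp (- 1) * \<phi> k 1 + exp (- 1) ^ 2" for k
  have "V \<longlonglongrightarrow> exp (- 2) - 2 * exp (- 1) * exp (- 1) + exp (- 1) ^ 2"
    unfolding V_def by (intro tendsto_intros lim)
  moreover have "exp (- 2) - 2 * exp (- 1) * exp (- 1) + exp (- 1) ^ 2 = (0 :: real)"
    using exp_double[of "- 1 :: real"] by (simp add: power2_eq_square)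
  ultimately have "V \<longlonglongrightarrow> 0" by simp
  then have V: "(\<lambda>k. V k / \<eta> ^ 2) \<longlonglongrightarrow> 0" by (rule tendsto_divide_zero)
  have "measure (\<mu> k) {y. \<delta> \<le> \<bar>y - 1\<bar>} \<le> V k / \<eta> ^ 2" for k
  proof -
    interpret real_distribution "\<mu> k" using \<mu>[of k] by (simp add: has_laplace_transform_def)
    let ?A = "{y :: real. \<delta> \<le> \<bar>y - 1\<bar>}"
    have A [measurable]: "?A \<in> sets borel" by measurable
    have int: "integrable (\<mu> k) (\<lambda>y. exp (- y))" "integrable (\<mu> k) (\<lambda>y. exp (- (2 * y)))"
      using has_laplace_transform_integrable[OF \<mu>[of k], of 1] has_laplace_transform_integrable[OF \<mu>[of k], of 2]
      by simp_all
    have sq: "(exp (- y) - exp (- 1)) ^ 2 = exp (- (2 * y)) - 2 * exp (- 1) * exp (- y) + exp (- 1) ^ 2" for y :: real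
      using exp_double[of "- y"] by (simp add: power2_diff)
    have "\<eta> ^ 2 * prob ?A = (\<integral>y. \<eta> ^ 2 * indicator ?A y \<partial>\<mu> k)" by simp
    also have "\<dots> \<le> (\<integral>y. (exp (- y) - exp (- 1)) ^ 2 \<partial>\<mu> k)"
    proof (rule integral_mono)
      show "\<eta> ^ 2 * indicator ?A y \<le> (exp (- y) - exp (- 1)) ^ 2" for y
        using far[of y] \<eta> power_mono[of \<eta> "\<bar>exp (- y) - exp (- 1)\<bar>" 2] by (auto simp: indicator_def)
      show "integrable (\<mu> k) (\<lambda>y. \<eta> ^ 2 * indicator ?A y)"
        by (intro integrable_mult_right integrable_real_indicator) (simp_all add: emeasure_eq_measure)
      show "integrable (\<mu> k) (\<lambda>y. (exp (- y) - exp (- 1)) ^ 2)"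
        unfolding sq using int by simp
    qed
    also have "\<dots> = V k"
    proof -
      have "(\<integral>y. exp (- (1 * y)) \<partial>\<mu> k) = \<phi> k 1" "(\<integral>y. exp (- (2 * y)) \<partial>\<mu> k) = \<phi> k 2"
        by (rule has_laplace_transformD[OF \<mu>], simp)+
      then show ?thesis unfolding sq V_def using int prob_space by simp
    qed
    finally show ?thesis using \<eta> by (simp add: field_simps)
  qed
  then have "norm (measure (\<mu> k) {y. \<delta> \<le> \<bar>y - 1\<bar>}) \<le> V k / \<eta> ^ 2" for k
    unfolding real_norm_def abs_of_nonneg[OF measure_nonneg] .
  then show ?thesis
    by (intro Lim_null_comparison[OF _ V] always_eventually allI)
qed

text \<open>
  The mass at \<open>0\<close> is a lower bound for the transform.
\<close>
lemma has_laplace_transform_AE_pos: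
  assumes \<mu>: "has_laplace_transform \<mu> \<phi>" and lim: "(\<phi> \<longlongrightarrow> 0) at_top"
  shows "AE y in \<mu>. 0 < y"
proof -
  interpret real_distribution \<mu> using \<mu> by (simp add: has_laplace_transform_def)
  have "prob {0} \<le> \<phi> \<theta>" if \<theta>: "0 \<le> \<theta>" for \<theta>
  proof -
    have "prob {0} = (\<integral>y. indicator {0} y \<partial>\<mu>)" by simp
    also have "\<dots> \<le> (\<integral>y. exp (- (\<theta> * y)) \<partial>\<mu>)"
    proof (rule integral_mono)
      show "integrable \<mu> (indicator {0} :: real \<Rightarrow> real)"
        by (intro integrable_real_indicator) (simp_all add: emeasure_eq_measure)
      show "integrable \<mu> (\<lambda>y. exp (- (\<theta> * y)))"
        by (rule has_laplace_transform_integrable[OF \<mu> \<theta>])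
    qed (simp add: indicator_def)
    finally show ?thesis using \<mu> \<theta> by (simp add: has_laplace_transform_def)
  qed
  then have "prob {0} \<le> 0"
    by (intro tendsto_lowerbound[OF lim]) (auto intro: eventually_mono[OF eventually_ge_at_top[of 0]])
  then have "prob {0} = 0" by (simp add: measure_le_0_iff)
  then have "AE y in \<mu>. y \<notin> {0}"
    by (subst (asm) prob_eq_0) auto
  moreover have "AE y in \<mu>. 0 \<le> y" using \<mu> by (simp add: has_laplace_transform_def)
  ultimately show ?thesis by eventually_elim auto
qed

lemma borel_measurable_vec_lambda [measurable (raw)]:
  fixes f :: "'n::finite \<Rightarrow> 'a \<Rightarrow> real"
  assumes "\<And>j. f j \<in> borel_measurable N"
  shows "(\<lambda>x. \<chi> j. f j x) \<in> borel_measurable N"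
  by (subst borel_measurable_euclidean_space) (use assms in \<open>auto simp: Basis_vec_def inner_axis\<close>)

lemma borel_measurable_vec_component [measurable (raw)]:
  fixes f :: "'a \<Rightarrow> real^'n"
  assumes "f \<in> borel_measurable N"
  shows "(\<lambda>x. f x $ j) \<in> borel_measurable N"
  using measurable_compose[OF assms borel_measurable_continuous_onI[of "\<lambda>x. x $ j"]]
  by (simp add: continuous_on_component)

text \<open>
  For exponents in \<open>{0..B}\<close> the power \<open>y powr e\<close> lies between \<open>1\<close> and \<open>y powr B\<close>, so all coordinates are
  controlled by the continuity of \<open>y powr B\<close> at \<open>1\<close>.
\<close>
lemma power_vector_concentration:
  fixes e :: "nat \<Rightarrow> 'n::finite \<Rightarrow> real"
  assumes \<mu>: "\<And>k. real_distribution (\<mu> k)"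
    and conc: "\<And>\<delta>. 0 < \<delta> \<Longrightarrow> (\<lambda>k. measure (\<mu> k) {y. \<delta> \<le> \<bar>y - 1\<bar>}) \<longlonglongrightarrow> 0"
    and e: "\<And>k j. 0 \<le> e k j" "\<And>k j. e k j \<le> B"
    and \<delta>: "0 < \<delta>"
  shows "(\<lambda>k. measure (\<mu> k) {y. \<delta> \<le> norm ((\<chi> j. y powr e k j) - 1)}) \<longlonglongrightarrow> 0"
proof -
  have "isCont (\<lambda>y::real. y powr B) 1" by (intro continuous_intros) auto
  then obtain d where d: "0 < d" "\<And>y. \<bar>y - 1\<bar> < d \<Longrightarrow> \<bar>y powr B - 1\<bar> < \<delta> / real CARD('n)"
    using \<delta> unfolding continuous_at_eps_delta dist_real_def
    by (metis divide_pos_pos of_nat_0_less_iff powr_one_eq_one zero_less_card_finite)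
  define \<eta> where "\<eta> = min d 1"
  have \<eta>: "0 < \<eta>" "\<eta> \<le> d" "\<eta> \<le> 1" using d by (auto simp: \<eta>_def)
  have near: "norm ((\<chi> j. y powr e k j) - 1 :: real^'n) < \<delta>" if y: "\<bar>y - 1\<bar> < \<eta>" for k y
  proof -
    have pos: "0 < y" using y \<eta> by linarith
    have "\<bar>y powr e k j - 1\<bar> \<le> \<bar>y powr B - 1\<bar>" for j
    proof (cases "1 \<le> y")
      case True
      then have "1 \<le> y powr e k j" "y powr e k j \<le> y powr B"
        using e[of k j] by (auto intro: ge_one_powr_ge_zero powr_mono)
      then show ?thesis by linarith
    next
      case False
      then have "y powr e k j \<le> 1" "y powr B \<le> y powr e k j"
        using e[of k j] pos by (auto intro: powr_le1 powr_mono')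
      then show ?thesis by linarith
    qed
    moreover have "\<bar>y powr B - 1\<bar> < \<delta> / real CARD('n)" using d(2) y \<eta> by simp
    ultimately have "\<bar>y powr e k j - 1\<bar> < \<delta> / real CARD('n)" for j
      by (rule le_less_trans)
    then have "(\<Sum>j\<in>UNIV. \<bar>((\<chi> j. y powr e k j) - 1 :: real^'n) $ j\<bar>) < (\<Sum>j\<in>(UNIV :: 'n set). \<delta> / real CARD('n))"
      by (intro sum_strict_mono) auto
    then show ?thesis using norm_le_l1_cart[of "(\<chi> j. y powr e k j) - 1 :: real^'n"] by simp
  qed
  have le: "norm (measure (\<mu> k) {y. \<delta> \<le> norm ((\<chi> j. y powr e k j) - 1)}) \<le> measure (\<mu> k) {y. \<eta> \<le> \<bar>y - 1\<bar>}" for k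
  proof -
    interpret real_distribution "\<mu> k" by (rule \<mu>)
    have "prob {y. \<delta> \<le> norm ((\<chi> j. y powr e k j) - 1)} \<le> prob {y. \<eta> \<le> \<bar>y - 1\<bar>}"
    proof (rule finite_measure_mono)
      show "{y. \<delta> \<le> norm ((\<chi> j. y powr e k j) - 1)} \<subseteq> {y. \<eta> \<le> \<bar>y - 1\<bar>}"
        using near[of _ k] by (auto simp: not_less[symmetric])
      show "{y. \<eta> \<le> \<bar>y - 1\<bar>} \<in> events" unfolding events_eq_borel by measurable
    qed
    then show ?thesis by simp
  qed
  show ?thesis
    by (rule Lim_null_comparison[OF _ conc[OF \<eta>(1)]]) (intro always_eventually allI le)
qed

lemma small_power_concentration:
  assumes \<mu>: "real_distribution \<mu>" and pos: "AE y in \<mu>. 0 < y" and \<delta>: "0 < \<delta>"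
  shows "(\<lambda>k. measure \<mu> {y. \<delta> \<le> norm ((\<chi> j. y powr (1 / real (Suc k))) - (1 :: real^'n))}) \<longlonglongrightarrow> 0"
proof -
  interpret real_distribution \<mu> by (rule \<mu>)
  let ?A = "\<lambda>k. {y. \<delta> \<le> norm ((\<chi> j. y powr (1 / real (Suc k))) - (1 :: real^'n))}"
  have A [measurable]: "?A k \<in> sets borel" for k by measurable
  have "(\<lambda>k. \<integral>y. indicator (?A k) y \<partial>\<mu>) \<longlonglongrightarrow> (\<integral>y. (0::real) \<partial>\<mu>)"
  proof (rule integral_dominated_convergence[where w = "\<lambda>_. 1"])
    show "AE y in \<mu>. (\<lambda>k. indicator (?A k) y :: real) \<longlonglongrightarrow> 0"
      using pos
    proof eventually_elim
      case (elim y)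
      have "(\<lambda>k. (\<chi> j. y powr (1 / real (Suc k)))) \<longlonglongrightarrow> (1 :: real^'n)"
      proof (rule vec_tendstoI)
        fix i
        have "(\<lambda>k. y powr (1 / real (Suc k))) \<longlonglongrightarrow> y powr 0"
          using elim by (intro tendsto_intros LIMSEQ_Suc[OF lim_1_over_n]) auto
        then show "(\<lambda>k. (\<chi> j. y powr (1 / real (Suc k))) $ i) \<longlonglongrightarrow> (1 :: real^'n) $ i"
          using elim by simp
      qed
      then have "eventually (\<lambda>k. dist (\<chi> j. y powr (1 / real (Suc k))) (1 :: real^'n) < \<delta>) sequentially"
        using \<delta> by (rule tendstoD)
      then have "eventually (\<lambda>k. indicator (?A k) y = (0::real)) sequentially"
        by eventually_elim (simp add: indicator_def dist_norm)
      then show ?case by (rule tendsto_eventually)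
    qed
  qed (simp_all add: indicator_def)
  then show ?thesis by simp
qed

section \<open>Weak approximation by discretized and randomly rescaled vectors\<close>

text \<open>
  Conditionally on \<open>X = x\<close>, the vector \<open>U k * q k x\<close> converges to \<open>x\<close> in probability, so the conditional
  expectation \<open>g k x\<close> of a bounded continuous function \<open>f\<close> tends to \<open>f x\<close>; dominated convergence integrates
  this over \<open>M\<close>.  Multiplication of vectors is coordinatewise.
\<close>
lemma converges_weakly_mult_perturbation:
  fixes M :: "(real^'n) measure"
  assumes M: "M \<in> orthant_distributions" and \<mu>: "\<And>k. real_distribution (\<mu> k)"
    and q [measurable]: "\<And>k. q k \<in> borel_measurable borel"
    and q_lim: "\<And>x. (\<forall>j. 0 \<le> x $ j) \<Longrightarrow> (\<lambda>k. q k x) \<longlonglongrightarrow> x"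
    and U [measurable]: "\<And>k. U k \<in> borel_measurable borel"
    and U_lim: "\<And>\<delta>. 0 < \<delta> \<Longrightarrow> (\<lambda>k. measure (\<mu> k) {y. \<delta> \<le> norm (U k y - 1)}) \<longlonglongrightarrow> 0"
  shows "converges_weakly (\<lambda>k. distr (M \<Otimes>\<^sub>M \<mu> k) borel (\<lambda>(x, y). U k y * q k x)) M"
  unfolding converges_weakly_def
proof (intro allI impI, elim conjE)
  fix f :: "real^'n \<Rightarrow> real" assume f: "continuous_on UNIV f" "bounded (range f)"
  interpret M: prob_space M using M by (simp add: orthant_distributions_def)
  have sets_M [measurable_cong]: "sets M = sets borel" using M by (simp add: orthant_distributions_def)
  have [measurable]: "f \<in> borel_measurable borel" using f by (intro borel_measurable_continuous_onI)
  have mult [measurable]: "(\<lambda>p. fst p * snd p :: real^'n) \<in> borel_measurable (borel \<Otimes>\<^sub>M borel)"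
    unfolding borel_prod
    by (intro borel_measurable_continuous_onI)
       (auto simp: times_vec_def intro!: continuous_on_vec_lambda continuous_intros)
  obtain C where C: "\<And>x. \<bar>f x\<bar> \<le> C" using f(2) by (auto simp: bounded_iff)
  have C0: "0 \<le> C" using C[of 0] by linarith
  define g where "g k x = (\<integral>y. f (U k y * q k x) \<partial>\<mu> k)" for k x
  have meas: "(\<lambda>p. f (U k (snd p) * q k (fst p))) \<in> borel_measurable (borel \<Otimes>\<^sub>M borel)" for k
  proof -
    have "(\<lambda>p. (U k (snd p), q k (fst p))) \<in> borel \<Otimes>\<^sub>M borel \<rightarrow>\<^sub>M borel \<Otimes>\<^sub>M borel" by measurable
    from measurable_compose[OF this mult] show ?thesis by simp
  qed
  have sets_\<mu> [measurable_cong]: "sets (\<mu> k) = sets borel" for k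
    using \<mu>[of k] by (simp add: real_distribution_def real_distribution_axioms_def)
  have int_eq: "(\<integral>x. f x \<partial>distr (M \<Otimes>\<^sub>M \<mu> k) borel (\<lambda>(x, y). U k y * q k x)) = (\<integral>x. g k x \<partial>M)" for k
  proof -
    interpret \<mu>: real_distribution "\<mu> k" by (rule \<mu>)
    interpret pair_prob_space M "\<mu> k" ..
    have m: "(\<lambda>p. U k (snd p) * q k (fst p)) \<in> borel_measurable (M \<Otimes>\<^sub>M \<mu> k)"
    proof -
      have "(\<lambda>p. (U k (snd p), q k (fst p))) \<in> M \<Otimes>\<^sub>M \<mu> k \<rightarrow>\<^sub>M borel \<Otimes>\<^sub>M borel" by measurable
      from measurable_compose[OF this mult] show ?thesis by simp
    qed
    have "(\<integral>x. f x \<partial>distr (M \<Otimes>\<^sub>M \<mu> k) borel (\<lambda>(x, y). U k y * q k x)) =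
        (\<integral>p. f (U k (snd p) * q k (fst p)) \<partial>(M \<Otimes>\<^sub>M \<mu> k))"
      using m by (subst integral_distr) (auto simp: case_prod_beta)
    also have "\<dots> = (\<integral>x. g k x \<partial>M)"
    proof -
      have "integrable (M \<Otimes>\<^sub>M \<mu> k) (\<lambda>p. f (U k (snd p) * q k (fst p)))"
        using m C by (intro P.integrable_const_bound[where B = C]) auto
      from integral_fst'[OF this] show ?thesis by (simp add: g_def)
    qed
    finally show ?thesis .
  qed
  have g_lim: "(\<lambda>k. g k x) \<longlonglongrightarrow> f x" if x: "\<forall>j. 0 \<le> x $ j" for x
  proof (rule LIMSEQ_I)
    fix \<epsilon> :: real assume \<epsilon>: "0 < \<epsilon>"
    have "isCont (\<lambda>p. f (fst p * snd p)) (1, x)"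
    proof -
      have "continuous_on UNIV (\<lambda>p :: (real^'n) \<times> (real^'n). fst p * snd p)"
        by (auto simp: times_vec_def intro!: continuous_on_vec_lambda continuous_intros)
      then have "continuous_on UNIV (\<lambda>p. f (fst p * snd p))"
        by (intro continuous_on_compose2[OF f(1)]) auto
      then show ?thesis by (simp add: continuous_on_eq_continuous_at)
    qed
    then obtain d where d: "0 < d"
      "\<And>p. dist p (1, x) < d \<Longrightarrow> dist (f (fst p * snd p)) (f (1 * x)) < \<epsilon> / 3"
      using \<epsilon> unfolding continuous_at_eps_delta by (metis divide_pos_pos fst_conv snd_conv zero_less_numeral)
    have near: "\<bar>f (u * z) - f x\<bar> < \<epsilon> / 3" if "norm (u - 1) < d / 2" "norm (z - x) < d / 2" for u z
    proof -
      have "dist (u, z) (1, x) \<le> dist u 1 + dist z x"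
        by (simp add: dist_Pair_Pair sqrt_sum_squares_le_sum)
      then show ?thesis using d(2)[of "(u, z)"] that by (simp add: dist_norm)
    qed
    have "eventually (\<lambda>k. norm (q k x - x) < d / 2) sequentially"
      using tendstoD[OF q_lim[OF x], of "d / 2"] d(1) by (simp add: dist_norm)
    \<comment> \<open>The summand \<open>1\<close> in \<open>2 * C + 1\<close> keeps the denominator positive when \<open>C = 0\<close>.\<close>
    moreover have "eventually (\<lambda>k. measure (\<mu> k) {y. d / 2 \<le> norm (U k y - 1)} < \<epsilon> / (3 * (2 * C + 1))) sequentially"
      using U_lim[of "d / 2"] d(1) \<epsilon> C0 by (intro order_tendstoD) auto
    ultimately have "eventually (\<lambda>k. norm (g k x - f x) < \<epsilon>) sequentially"
    proof eventually_elim
      case (elim k)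
      interpret \<mu>: real_distribution "\<mu> k" by (rule \<mu>)
      let ?A = "{y. d / 2 \<le> norm (U k y - 1)}"
      have A [measurable]: "?A \<in> sets borel" by measurable
      have m [measurable]: "(\<lambda>y. f (U k y * q k x)) \<in> borel_measurable borel"
        using measurable_compose[OF _ meas[of k], of "\<lambda>y. (x, y)" borel] by simp
      have int: "integrable (\<mu> k) (\<lambda>y. f (U k y * q k x))"
        using C by (intro \<mu>.integrable_const_bound[where B = C]) auto
      have "norm (g k x - f x) = norm (\<integral>y. f (U k y * q k x) - f x \<partial>\<mu> k)"
        using int \<mu>.prob_space by (simp add: g_def)
      also have "\<dots> \<le> (\<integral>y. norm (f (U k y * q k x) - f x) \<partial>\<mu> k)"
        by (rule integral_norm_bound)
      also have "\<dots> \<le> (\<integral>y. \<epsilon> / 3 + 2 * C * indicator ?A y \<partial>\<mu> k)"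
      proof (rule integral_mono)
        show "norm (f (U k y * q k x) - f x) \<le> \<epsilon> / 3 + 2 * C * indicator ?A y" for y
        proof (cases "y \<in> ?A")
          case True
          then show ?thesis using C[of "U k y * q k x"] C[of x] \<epsilon> by auto
        next
          case False
          then show ?thesis using near[of "U k y" "q k x"] elim(1) by auto
        qed
      qed (use int in \<open>auto intro!: integrable_real_indicator simp: \<mu>.emeasure_eq_measure\<close>)
      also have "\<dots> = \<epsilon> / 3 + 2 * C * \<mu>.prob ?A"
        using \<mu>.prob_space by (subst Bochner_Integration.integral_add) (auto simp: \<mu>.emeasure_eq_measure)
      also have "\<dots> \<le> \<epsilon> / 3 + (2 * C + 1) * (\<epsilon> / (3 * (2 * C + 1)))"
        using elim(2) C0 by (intro add_left_mono mult_mono) auto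
      also have "\<dots> = \<epsilon> / 3 + \<epsilon> / 3" using C0 by (simp add: field_simps)
      also have "\<dots> < \<epsilon>" using \<epsilon> by simp
      finally show ?case .
    qed
    then show "\<exists>no. \<forall>k\<ge>no. norm (g k x - f x) < \<epsilon>" by (simp add: eventually_sequentially)
  qed
  have "(\<lambda>k. \<integral>x. g k x \<partial>M) \<longlonglongrightarrow> (\<integral>x. f x \<partial>M)"
  proof (rule integral_dominated_convergence[where w = "\<lambda>_. C"])
    show "AE x in M. (\<lambda>k. g k x) \<longlonglongrightarrow> f x"
      using M g_lim by (auto simp: orthant_distributions_def elim!: eventually_mono)
    show "g k \<in> borel_measurable M" for k
    proof -
      interpret \<mu>: real_distribution "\<mu> k" by (rule \<mu>)
      have "(\<lambda>(x, y). f (U k y * q k x)) \<in> borel_measurable (M \<Otimes>\<^sub>M \<mu> k)"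
        using meas[of k] by (simp add: case_prod_beta cong: measurable_cong_sets)
      from \<mu>.borel_measurable_lebesgue_integral[OF this] show ?thesis
        unfolding g_def by simp
    qed
    show "AE x in M. norm (g k x) \<le> C" for k
    proof (rule AE_I2)
      fix x
      interpret \<mu>: real_distribution "\<mu> k" by (rule \<mu>)
      have "norm (g k x) \<le> (\<integral>y. norm (f (U k y * q k x)) \<partial>\<mu> k)"
        unfolding g_def by (rule integral_norm_bound)
      also have "\<dots> \<le> (\<integral>y. C \<partial>\<mu> k)"
        using C C0 by (intro integral_mono') auto
      finally show "norm (g k x) \<le> C" using \<mu>.prob_space by simp
    qed
  qed simp_all
  then show "(\<lambda>k. \<integral>x. f x \<partial>distr (M \<Otimes>\<^sub>M \<mu> k) borel (\<lambda>(x, y). U k y * q k x)) \<longlonglongrightarrow> (\<integral>x. f x \<partial>M)"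
    by (simp add: int_eq)
qed

lemma simple_approximation_orthant:
  obtains q :: "nat \<Rightarrow> real^'n \<Rightarrow> real^'n"
  where "\<And>k. simple_function borel (q k)" "\<And>k x j. 0 \<le> q k x $ j"
    "\<And>x. (\<forall>j. 0 \<le> x $ j) \<Longrightarrow> (\<lambda>k. q k x) \<longlonglongrightarrow> x"
proof -
  obtain F :: "nat \<Rightarrow> real^'n \<Rightarrow> real^'n" where F: "\<And>k. simple_function borel (F k)"
    "\<And>x. (\<lambda>k. F k x) \<longlonglongrightarrow> x"
    using borel_measurable_implies_sequence_metric[of "\<lambda>x. x" borel 0] by auto
  \<comment> \<open>Taking absolute values keeps the approximants in the orthant and fixes the limit there.\<close>
  show ?thesis
  proof (rule that[of "\<lambda>k x. \<chi> j. \<bar>F k x $ j\<bar>"])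
    show "simple_function borel (\<lambda>x. \<chi> j. \<bar>F k x $ j\<bar>)" for k
      using simple_function_compose[OF F(1)[of k], of "\<lambda>z. \<chi> j. \<bar>z $ j\<bar>"] by (simp add: o_def)
    show "(\<lambda>k. \<chi> j. \<bar>F k x $ j\<bar>) \<longlonglongrightarrow> x" if "\<forall>j. 0 \<le> x $ j" for x
    proof (rule vec_tendstoI)
      fix i
      have "(\<lambda>k. \<bar>F k x $ i\<bar>) \<longlonglongrightarrow> \<bar>x $ i\<bar>" by (intro tendsto_intros F)
      then show "(\<lambda>k. (\<chi> j. \<bar>F k x $ j\<bar>) $ i) \<longlonglongrightarrow> x $ i" using that by simp
    qed
  qed simp
qed

section \<open>Rescaled discrete distributions as fractional phase-type distributions\<close>

text \<open>
  The values of the simple function \<open>s\<close> are the reward vectors of the parallel Erlang chains, and their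
  probabilities under \<open>M\<close> are the initial weights.
\<close>
lemma is_MPH_star_simple_mixture:
  fixes M :: "(real^'n) measure" and s :: "real^'n \<Rightarrow> real^'n"
  assumes M: "M \<in> orthant_distributions"
    and s: "simple_function borel s" "\<And>x j. 0 \<le> s x $ j"
    and m: "1 \<le> m" and \<mu>: "has_laplace_transform \<mu> (\<lambda>\<theta>. (real m / (real m + \<theta> powr \<alpha>)) ^ m)"
  shows "\<exists>p \<pi> T R. admissible p \<pi> T R \<and>
    is_MPH_star \<alpha> \<pi> T R (distr (M \<Otimes>\<^sub>M \<mu>) borel (\<lambda>(x, y). y *\<^sub>R s x))"
proof -
  interpret M: prob_space M using M by (simp add: orthant_distributions_def)
  interpret \<mu>: real_distribution \<mu> using \<mu> by (simp add: has_laplace_transform_def)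
  interpret pair_prob_space M \<mu> ..
  let ?L = "distr (M \<Otimes>\<^sub>M \<mu>) borel (\<lambda>(x, y). y *\<^sub>R s x)"
  have sets_M [measurable_cong]: "sets M = sets borel" using M by (simp add: orthant_distributions_def)
  have space_M [simp]: "space M = UNIV" using sets_eq_imp_space_eq[OF sets_M] by simp
  have s_meas [measurable]: "s \<in> borel_measurable borel" using s(1) by (rule borel_measurable_simple_function)
  have L_meas [measurable]: "(\<lambda>p. snd p *\<^sub>R s (fst p)) \<in> borel_measurable (M \<Otimes>\<^sub>M \<mu>)" by measurable
  have V: "finite (range s)" using s(1) by (simp add: simple_function_def)
  define K where "K = card (range s)"
  obtain v where v: "bij_betw v {..<K} (range s)"
    using ex_bij_betw_nat_finite[OF V] by (auto simp: K_def lessThan_atLeast0)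
  define w where "w l = M.prob (s -` {v l})" for l
  have event [measurable]: "s -` {z} \<in> sets M" for z
    using measurable_sets[OF s_meas, of "{z}"] by (simp add: sets_M)
  have mixture: "(\<integral>x. F (s x) \<partial>M) = (\<Sum>l<K. w l * F (v l))" for F :: "real^'n \<Rightarrow> real"
  proof -
    have "F (s x) = (\<Sum>z\<in>range s. F z * indicator (s -` {z}) x)" for x
      using V by (simp add: indicator_def of_bool_def if_distrib[of "(*) _"] cong: if_cong)
    then have "(\<integral>x. F (s x) \<partial>M) = (\<integral>x. (\<Sum>z\<in>range s. F z * indicator (s -` {z}) x) \<partial>M)"
      by simp
    also have "\<dots> = (\<Sum>z\<in>range s. F z * M.prob (s -` {z}))"
      by (subst Bochner_Integration.integral_sum) (auto simp: M.emeasure_eq_measure)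
    also have "\<dots> = (\<Sum>l<K. w l * F (v l))"
      by (subst sum.reindex_bij_betw[OF v, symmetric]) (simp add: w_def mult.commute)
    finally show ?thesis .
  qed
  have adm: "admissible (K * m) (erlang_initial K m w) (erlang_generator K m) (\<lambda>i. v (i div m))"
  proof (rule admissible_erlang[OF _ m])
    have "range s \<noteq> {}" by simp
    then show "1 \<le> K" using V unfolding K_def by (metis One_nat_def Suc_leI card_gt_0_iff)
    show "(\<Sum>l<K. w l) = 1" using mixture[of "\<lambda>_. 1"] M.prob_space by simp
    show "0 \<le> v l $ j" if "l < K" for l j
    proof -
      have "v l \<in> range s" using v that by (auto simp: bij_betw_def)
      then show ?thesis using s(2) by auto
    qed
  qed (simp add: w_def)
  have nonneg: "AE p in M \<Otimes>\<^sub>M \<mu>. 0 \<le> snd p"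
  proof (rule AE_pair_measure)
    show "{p \<in> space (M \<Otimes>\<^sub>M \<mu>). 0 \<le> snd p} \<in> sets (M \<Otimes>\<^sub>M \<mu>)" by measurable
    show "AE x in M. AE y in \<mu>. 0 \<le> snd (x, y)"
      using \<mu> by (simp add: has_laplace_transform_def)
  qed
  have "prob_space ?L" using L_meas by (intro P.prob_space_distr) (simp add: case_prod_beta)
  moreover have "AE x in ?L. \<forall>j. 0 \<le> x $ j"
  proof (subst AE_distr_iff)
    show "{x \<in> space borel. \<forall>j. 0 \<le> (x :: real^'n) $ j} \<in> sets borel" by measurable
    show "AE p in M \<Otimes>\<^sub>M \<mu>. \<forall>j. 0 \<le> (case p of (x, y) \<Rightarrow> y *\<^sub>R s x) $ j"
      using nonneg by eventually_elim (use s(2) in \<open>auto simp: case_prod_beta\<close>)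
  qed (use L_meas in \<open>simp add: case_prod_beta\<close>)
  ultimately have L: "?L \<in> orthant_distributions" by (simp add: orthant_distributions_def)
  have "(\<integral>x. exp (- (x \<bullet> \<theta>)) \<partial>?L) = mph_laplace \<alpha> (erlang_initial K m w) (erlang_generator K m) (\<lambda>i. v (i div m)) \<theta>"
    if \<theta>: "\<forall>j. 0 \<le> \<theta> $ j" for \<theta>
  proof -
    have s\<theta>: "0 \<le> s x \<bullet> \<theta>" for x
      unfolding inner_vec_def using s(2) \<theta> by (intro sum_nonneg) simp
    have "(\<integral>x. exp (- (x \<bullet> \<theta>)) \<partial>?L) = (\<integral>p. exp (- ((s (fst p) \<bullet> \<theta>) * snd p)) \<partial>(M \<Otimes>\<^sub>M \<mu>))"
      using L_meas by (subst integral_distr) (auto simp: case_prod_beta mult.commute)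
    also have "\<dots> = (\<integral>x. \<integral>y. exp (- ((s x \<bullet> \<theta>) * y)) \<partial>\<mu> \<partial>M)"
    proof -
      have "integrable (M \<Otimes>\<^sub>M \<mu>) (\<lambda>p. exp (- ((s (fst p) \<bullet> \<theta>) * snd p)))"
      proof (rule P.integrable_const_bound[where B = 1])
        show "AE p in M \<Otimes>\<^sub>M \<mu>. norm (exp (- ((s (fst p) \<bullet> \<theta>) * snd p))) \<le> 1"
          using nonneg by eventually_elim (use s\<theta> in auto)
      qed measurable
      from integral_fst'[OF this] show ?thesis by simp
    qed
    also have "\<dots> = (\<integral>x. (real m / (real m + (s x \<bullet> \<theta>) powr \<alpha>)) ^ m \<partial>M)"
      using has_laplace_transformD[OF \<mu> s\<theta>] by simp
    also have "\<dots> = (\<Sum>l<K. w l * (real m / (real m + (v l \<bullet> \<theta>) powr \<alpha>)) ^ m)"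
      by (rule mixture)
    finally show ?thesis by (simp add: mph_laplace_erlang[OF m])
  qed
  with L adm show ?thesis unfolding is_MPH_star_def by blast
qed

text \<open>
  The rewards are \<open>q x $ j powr \<nu> $ j\<close>, so that the final powers \<open>1 / \<nu> $ j\<close> restore the point \<open>q x\<close>.
\<close>
lemma is_MPH_star_power_simple_mixture:
  fixes M :: "(real^'n) measure" and q :: "real^'n \<Rightarrow> real^'n"
  assumes M: "M \<in> orthant_distributions"
    and q: "simple_function borel q" "\<And>x j. 0 \<le> q x $ j"
    and \<nu>: "\<And>j. 0 < \<nu> $ j"
    and m: "1 \<le> m" and \<mu>: "has_laplace_transform \<mu> (\<lambda>\<theta>. (real m / (real m + \<theta> powr \<alpha>)) ^ m)"
  shows "\<exists>p \<pi> T R. admissible p \<pi> T R \<and>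
    is_MPH_star_power \<nu> \<alpha> \<pi> T R (distr (M \<Otimes>\<^sub>M \<mu>) borel (\<lambda>(x, y). (\<chi> j. y powr (1 / \<nu> $ j)) * q x))"
proof -
  define s where "s x = (\<chi> j. q x $ j powr \<nu> $ j)" for x
  have s: "simple_function borel s" "\<And>x j. 0 \<le> s x $ j"
    using simple_function_compose[OF q(1), of "\<lambda>z. \<chi> j. z $ j powr \<nu> $ j"]
    by (simp_all add: s_def[abs_def] o_def)
  have [measurable_cong]: "sets M = sets borel" "sets \<mu> = sets borel"
    using M \<mu> by (simp_all add: orthant_distributions_def has_laplace_transform_def real_distribution_def
        real_distribution_axioms_def)
  have [measurable]: "s \<in> borel_measurable borel" using s(1) by (rule borel_measurable_simple_function)
  have "(\<lambda>x. \<chi> j. (x $ j) powr (1 / \<nu> $ j)) \<circ> (\<lambda>(x, y). y *\<^sub>R s x) = (\<lambda>(x, y). (\<chi> j. y powr (1 / \<nu> $ j)) * q x)"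
  proof -
    have "(y * s x $ j) powr (1 / \<nu> $ j) = y powr (1 / \<nu> $ j) * q x $ j" for x y j
      using \<nu>[of j] q(2)[of x j] by (simp add: s_def powr_mult powr_powr)
    then show ?thesis by (simp add: fun_eq_iff Finite_Cartesian_Product.vec_eq_iff)
  qed
  moreover have "distr (distr (M \<Otimes>\<^sub>M \<mu>) borel (\<lambda>(x, y). y *\<^sub>R s x)) borel (\<lambda>x. \<chi> j. (x $ j) powr (1 / \<nu> $ j)) =
      distr (M \<Otimes>\<^sub>M \<mu>) borel ((\<lambda>x. \<chi> j. (x $ j) powr (1 / \<nu> $ j)) \<circ> (\<lambda>(x, y). y *\<^sub>R s x))"
    by (rule distr_distr) measurable
  ultimately have eq: "distr (M \<Otimes>\<^sub>M \<mu>) borel (\<lambda>(x, y). (\<chi> j. y powr (1 / \<nu> $ j)) * q x) =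
      distr (distr (M \<Otimes>\<^sub>M \<mu>) borel (\<lambda>(x, y). y *\<^sub>R s x)) borel (\<lambda>x. \<chi> j. (x $ j) powr (1 / \<nu> $ j))"
    by (simp only:)
  obtain p \<pi> T R where "admissible p \<pi> T R"
    "is_MPH_star \<alpha> \<pi> T R (distr (M \<Otimes>\<^sub>M \<mu>) borel (\<lambda>(x, y). y *\<^sub>R s x))"
    using is_MPH_star_simple_mixture[OF M s m \<mu>] by blast
  then show ?thesis unfolding is_MPH_star_power_def eq by blast
qed

lemma is_MPH_star_power_orthant:
  fixes M :: "(real^'n) measure"
  assumes "is_MPH_star_power \<nu> \<alpha> \<pi> T R M"
  shows "M \<in> orthant_distributions"
proof -
  let ?h = "\<lambda>x :: real^'n. \<chi> j. (x $ j) powr (1 / \<nu> $ j)"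
  obtain L where L: "L \<in> orthant_distributions" and M: "M = distr L borel ?h"
    using assms by (auto simp: is_MPH_star_power_def is_MPH_star_def)
  interpret prob_space L using L by (simp add: orthant_distributions_def)
  have [measurable_cong]: "sets L = sets borel" using L by (simp add: orthant_distributions_def)
  have "AE x in M. \<forall>j. 0 \<le> x $ j"
    unfolding M by (subst AE_distr_iff) auto
  moreover have "prob_space M"
    unfolding M by (intro prob_space_distr) measurable
  moreover have "sets M = sets borel" by (simp add: M)
  ultimately show ?thesis by (simp add: orthant_distributions_def)
qed

lemma is_MPH_star_power_one:
  fixes M :: "(real^'n) measure"
  assumes "is_MPH_star_power 1 \<alpha> \<pi> T R M"
  shows "is_MPH_star \<alpha> \<pi> T R M"
proof -
  obtain L where L: "is_MPH_star \<alpha> \<pi> T R L" and M: "M = distr L borel (\<lambda>x. \<chi> j. (x $ j) powr (1 / (1 :: real^'n) $ j))"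
    using assms by (auto simp: is_MPH_star_power_def)
  have sets_L [measurable_cong]: "sets L = sets borel" and "AE x in L. \<forall>j. 0 \<le> x $ j"
    using L by (simp_all add: is_MPH_star_def orthant_distributions_def)
  then have "M = distr L borel (\<lambda>x. x)"
    unfolding M by (intro distr_cong_AE) (auto simp: Finite_Cartesian_Product.vec_eq_iff elim!: eventually_mono
        intro!: borel_measurable_vec_lambda)
  also have "\<dots> = L" by (rule distr_id2[OF sets_L[symmetric]])
  finally show ?thesis using L by simp
qed

section \<open>Density\<close>

lemma mph_power_approximation:
  fixes M :: "(real^'n) measure" and \<nu> :: "nat \<Rightarrow> real^'n"
  assumes M: "M \<in> orthant_distributions" and \<nu>: "\<And>k j. 0 < \<nu> k $ j" and m: "\<And>k. 1 \<le> m k"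
    and \<mu>: "\<And>k. has_laplace_transform (\<mu> k) (\<lambda>\<theta>. (real (m k) / (real (m k) + \<theta> powr \<alpha> k)) ^ m k)"
    and conc: "\<And>\<delta>. 0 < \<delta> \<Longrightarrow>
      (\<lambda>k. measure (\<mu> k) {y. \<delta> \<le> norm ((\<chi> j. y powr (1 / \<nu> k $ j)) - 1)}) \<longlonglongrightarrow> 0"
  shows "\<exists>Ms. (\<forall>k. \<exists>p \<pi> T R. admissible p \<pi> T R \<and> is_MPH_star_power (\<nu> k) (\<alpha> k) \<pi> T R (Ms k)) \<and>
    converges_weakly Ms M"
proof -
  obtain q :: "nat \<Rightarrow> real^'n \<Rightarrow> real^'n" where q: "\<And>k. simple_function borel (q k)" "\<And>k x j. 0 \<le> q k x $ j"
    "\<And>x. (\<forall>j. 0 \<le> x $ j) \<Longrightarrow> (\<lambda>k. q k x) \<longlonglongrightarrow> x"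
    using simple_approximation_orthant by blast
  let ?Ms = "\<lambda>k. distr (M \<Otimes>\<^sub>M \<mu> k) borel (\<lambda>(x, y). (\<chi> j. y powr (1 / \<nu> k $ j)) * q k x)"
  have "\<exists>p \<pi> T R. admissible p \<pi> T R \<and> is_MPH_star_power (\<nu> k) (\<alpha> k) \<pi> T R (?Ms k)" for k
    by (rule is_MPH_star_power_simple_mixture[OF M q(1) q(2) \<nu> m \<mu>])
  moreover have "converges_weakly ?Ms M"
  proof (rule converges_weakly_mult_perturbation[OF M])
    show "real_distribution (\<mu> k)" for k using \<mu>[of k] by (simp add: has_laplace_transform_def)
    show "q k \<in> borel_measurable borel" for k using q(1) by (rule borel_measurable_simple_function)
  qed (use q(3) conc in auto)
  ultimately show ?thesis by (intro exI[of _ ?Ms] conjI allI)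
qed

lemma MPH_star_weakly_dense:
  shows "weakly_dense_in
     {M :: (real^'n) measure. \<exists>\<alpha> p \<pi> T R.
        0 < \<alpha> \<and> \<alpha> \<le> 1 \<and> admissible p \<pi> T R \<and> is_MPH_star \<alpha> \<pi> T R M}
     orthant_distributions"
  unfolding weakly_dense_in_def
proof (intro conjI ballI subsetI)
  fix M :: "(real^'n) measure" assume M: "M \<in> orthant_distributions"
  have "\<forall>k. \<exists>\<mu>. has_laplace_transform \<mu> (\<lambda>\<theta>. (real (Suc k) / (real (Suc k) + \<theta> powr 1)) ^ Suc k)"
    by (intro allI has_laplace_transform_gamma_stable) simp_all
  from choice[OF this] obtain \<mu>
    where "\<forall>k. has_laplace_transform (\<mu> k) (\<lambda>\<theta>. (real (Suc k) / (real (Suc k) + \<theta> powr 1)) ^ Suc k)"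
    by (rule exE)
  then have \<mu>: "has_laplace_transform (\<mu> k) (\<lambda>\<theta>. (real (Suc k) / (real (Suc k) + \<theta> powr 1)) ^ Suc k)" for k
    by (rule spec)
  have "\<exists>Ms. (\<forall>k. \<exists>p \<pi> T R. admissible p \<pi> T R \<and> is_MPH_star_power 1 1 \<pi> T R (Ms k)) \<and>
      converges_weakly Ms M"
  proof (rule mph_power_approximation[OF M _ _ \<mu>])
    fix \<delta> :: real assume "0 < \<delta>"
    show "(\<lambda>k. measure (\<mu> k) {y. \<delta> \<le> norm ((\<chi> j. y powr (1 / (1 :: real^'n) $ j)) - 1)}) \<longlonglongrightarrow> 0"
    proof (rule power_vector_concentration[where B = 1])
      show "(\<lambda>k. measure (\<mu> k) {y. \<delta>' \<le> \<bar>y - 1\<bar>}) \<longlonglongrightarrow> 0" if "0 < \<delta>'" for \<delta>'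
      proof (rule has_laplace_transform_concentration[OF \<mu> _ _ that])
        show "(\<lambda>k. (real (Suc k) / (real (Suc k) + 1 powr 1)) ^ Suc k) \<longlonglongrightarrow> exp (- 1 :: real)"
          by real_asymp
        show "(\<lambda>k. (real (Suc k) / (real (Suc k) + 2 powr 1)) ^ Suc k) \<longlonglongrightarrow> exp (- 2 :: real)"
          by real_asymp
      qed
    qed (use \<mu> \<open>0 < \<delta>\<close> in \<open>auto simp: has_laplace_transform_def\<close>)
  qed auto
  then obtain Ms where Ms: "\<forall>k. \<exists>p \<pi> T R. admissible p \<pi> T R \<and> is_MPH_star_power 1 1 \<pi> T R (Ms k)"
    "converges_weakly Ms M"
    by (elim exE conjE)
  have "Ms k \<in> {M. \<exists>\<alpha> p \<pi> T R. 0 < \<alpha> \<and> \<alpha> \<le> 1 \<and> admissible p \<pi> T R \<and> is_MPH_star \<alpha> \<pi> T R M}" for k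
  proof -
    obtain p \<pi> T R where "admissible p \<pi> T R" "is_MPH_star 1 \<pi> T R (Ms k)"
      using Ms(1)[rule_format, of k] by (elim exE conjE) (drule is_MPH_star_power_one)
    then show ?thesis
      by (intro CollectI exI[of _ "1::real"] exI[of _ p] exI[of _ \<pi>] exI[of _ T] exI[of _ R] conjI) simp_all
  qed
  then show "\<exists>Ms. (\<forall>k. Ms k \<in> {M. \<exists>\<alpha> p \<pi> T R. 0 < \<alpha> \<and> \<alpha> \<le> 1 \<and> admissible p \<pi> T R \<and> is_MPH_star \<alpha> \<pi> T R M}) \<and>
      converges_weakly Ms M"
    using Ms(2) by (intro exI[of _ Ms] conjI allI)
qed (auto simp: is_MPH_star_def)

lemma MPH_star_power_weakly_dense_fixed_order:
  assumes \<alpha>: "0 < \<alpha> \<and> \<alpha> \<le> 1"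
  shows "weakly_dense_in
       {M :: (real^'n) measure. \<exists>\<nu> p \<pi> T R.
          (\<forall>j. 0 < \<nu> $ j) \<and> admissible p \<pi> T R \<and> is_MPH_star_power \<nu> \<alpha> \<pi> T R M}
       orthant_distributions"
  unfolding weakly_dense_in_def
proof (intro conjI ballI subsetI)
  fix M :: "(real^'n) measure" assume M: "M \<in> orthant_distributions"
  obtain \<mu> where \<mu>: "has_laplace_transform \<mu> (\<lambda>\<theta>. (real 1 / (real 1 + \<theta> powr \<alpha>)) ^ 1)"
    using has_laplace_transform_gamma_stable[of \<alpha> 1] \<alpha> by auto
  have dist: "real_distribution \<mu>" using \<mu> by (simp add: has_laplace_transform_def)
  have "((\<lambda>\<theta>. (real 1 / (real 1 + \<theta> powr \<alpha>)) ^ 1) \<longlongrightarrow> 0) at_top"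
    using \<alpha>[THEN conjunct1] by real_asymp
  with \<mu> have pos: "AE y in \<mu>. 0 < y" by (rule has_laplace_transform_AE_pos)
  \<comment> \<open>High roots of a single Mittag-Leffler variable.\<close>
  define \<nu> :: "nat \<Rightarrow> real^'n" where "\<nu> k = (\<chi> j. real (Suc k))" for k
  have \<nu>: "0 < \<nu> k $ j" for k j by (simp add: \<nu>_def)
  have "\<exists>Ms. (\<forall>k. \<exists>p \<pi> T R. admissible p \<pi> T R \<and> is_MPH_star_power (\<nu> k) \<alpha> \<pi> T R (Ms k)) \<and>
      converges_weakly Ms M"
  proof (rule mph_power_approximation[OF M \<nu> _ \<mu>])
    show "(\<lambda>k. measure \<mu> {y. \<delta> \<le> norm ((\<chi> j. y powr (1 / \<nu> k $ j)) - 1)}) \<longlonglongrightarrow> 0" if "0 < \<delta>" for \<delta>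
      using small_power_concentration[OF dist pos that] by (simp add: \<nu>_def)
  qed simp
  then obtain Ms where Ms: "\<forall>k. \<exists>p \<pi> T R. admissible p \<pi> T R \<and> is_MPH_star_power (\<nu> k) \<alpha> \<pi> T R (Ms k)"
    "converges_weakly Ms M"
    by (elim exE conjE)
  have "Ms k \<in> {M. \<exists>\<nu> p \<pi> T R. (\<forall>j. 0 < \<nu> $ j) \<and> admissible p \<pi> T R \<and> is_MPH_star_power \<nu> \<alpha> \<pi> T R M}" for k
    using Ms(1)[rule_format, of k] \<nu>[of k] by (intro CollectI exI[of _ "\<nu> k"]) simp
  then show "\<exists>Ms. (\<forall>k. Ms k \<in> {M. \<exists>\<nu> p \<pi> T R. (\<forall>j. 0 < \<nu> $ j) \<and> admissible p \<pi> T R \<and> is_MPH_star_power \<nu> \<alpha> \<pi> T R M}) \<and>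
      converges_weakly Ms M"
    using Ms(2) by (intro exI[of _ Ms] conjI allI)
qed (auto dest: is_MPH_star_power_orthant)

lemma MPH_star_power_weakly_dense_fixed_tail:
  fixes c :: "real^'n"
  assumes c: "\<forall>j. 0 < c $ j"
  shows "weakly_dense_in
       {M :: (real^'n) measure. \<exists>\<alpha> \<nu> p \<pi> T R.
          0 < \<alpha> \<and> \<alpha> < 1 \<and> (\<forall>j. 0 < \<nu> $ j) \<and> (\<forall>j. \<alpha> * \<nu> $ j = c $ j) \<and>
          admissible p \<pi> T R \<and> is_MPH_star_power \<nu> \<alpha> \<pi> T R M}
       orthant_distributions"
  unfolding weakly_dense_in_def
proof (intro conjI ballI subsetI)
  fix M :: "(real^'n) measure" assume M: "M \<in> orthant_distributions"
  \<comment> \<open>Any sequence in \<open>{0<..<1}\<close> with limit \<open>1\<close> would do.\<close>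
  define \<alpha> where "\<alpha> k = 1 - 1 / (real k + 2)" for k
  have \<alpha>: "0 < \<alpha> k" "\<alpha> k < 1" for k by (auto simp: \<alpha>_def)
  define \<nu> :: "nat \<Rightarrow> real^'n" where "\<nu> k = (\<chi> j. c $ j / \<alpha> k)" for k
  have \<nu>: "0 < \<nu> k $ j" "\<alpha> k * \<nu> k $ j = c $ j" for k j using c \<alpha>[of k] by (simp_all add: \<nu>_def)
  have "\<forall>k. \<exists>\<mu>. has_laplace_transform \<mu> (\<lambda>\<theta>. (real (Suc k) / (real (Suc k) + \<theta> powr \<alpha> k)) ^ Suc k)"
    using \<alpha> by (intro allI has_laplace_transform_gamma_stable) (simp_all add: less_imp_le)
  from choice[OF this] obtain \<mu>
    where "\<forall>k. has_laplace_transform (\<mu> k) (\<lambda>\<theta>. (real (Suc k) / (real (Suc k) + \<theta> powr \<alpha> k)) ^ Suc k)"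
    by (rule exE)
  then have \<mu>: "has_laplace_transform (\<mu> k) (\<lambda>\<theta>. (real (Suc k) / (real (Suc k) + \<theta> powr \<alpha> k)) ^ Suc k)" for k
    by (rule spec)
  define B where "B = Max (range (\<lambda>j. 1 / c $ j))"
  have "\<exists>Ms. (\<forall>k. \<exists>p \<pi> T R. admissible p \<pi> T R \<and> is_MPH_star_power (\<nu> k) (\<alpha> k) \<pi> T R (Ms k)) \<and>
      converges_weakly Ms M"
  proof (rule mph_power_approximation[OF M \<nu>(1) _ \<mu>])
    fix \<delta> :: real assume "0 < \<delta>"
    show "(\<lambda>k. measure (\<mu> k) {y. \<delta> \<le> norm ((\<chi> j. y powr (1 / \<nu> k $ j)) - 1)}) \<longlonglongrightarrow> 0"
    proof (rule power_vector_concentration)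
      show "(\<lambda>k. measure (\<mu> k) {y. \<delta>' \<le> \<bar>y - 1\<bar>}) \<longlonglongrightarrow> 0" if "0 < \<delta>'" for \<delta>'
      proof (rule has_laplace_transform_concentration[OF \<mu> _ _ that])
        show "(\<lambda>k. (real (Suc k) / (real (Suc k) + 1 powr \<alpha> k)) ^ Suc k) \<longlonglongrightarrow> exp (- 1 :: real)"
          unfolding \<alpha>_def by real_asymp
        show "(\<lambda>k. (real (Suc k) / (real (Suc k) + 2 powr \<alpha> k)) ^ Suc k) \<longlonglongrightarrow> exp (- 2 :: real)"
          unfolding \<alpha>_def by real_asymp
      qed
      show "1 / \<nu> k $ j \<le> B" for k j
      proof -
        have "1 / \<nu> k $ j = \<alpha> k * (1 / c $ j)" by (simp add: \<nu>_def)
        also have "\<dots> \<le> 1 * (1 / c $ j)"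
          using \<alpha>[of k] c by (intro mult_right_mono) (auto simp: less_imp_le)
        also have "\<dots> \<le> B" unfolding B_def by (simp add: Max_ge)
        finally show ?thesis .
      qed
    qed (use \<mu> \<open>0 < \<delta>\<close> \<nu>(1) in \<open>auto simp: has_laplace_transform_def less_imp_le\<close>)
  qed simp
  then obtain Ms where Ms: "\<forall>k. \<exists>p \<pi> T R. admissible p \<pi> T R \<and> is_MPH_star_power (\<nu> k) (\<alpha> k) \<pi> T R (Ms k)"
    "converges_weakly Ms M"
    by (elim exE conjE)
  have "Ms k \<in> {M. \<exists>\<alpha> \<nu> p \<pi> T R. 0 < \<alpha> \<and> \<alpha> < 1 \<and> (\<forall>j. 0 < \<nu> $ j) \<and> (\<forall>j. \<alpha> * \<nu> $ j = c $ j) \<and>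
          admissible p \<pi> T R \<and> is_MPH_star_power \<nu> \<alpha> \<pi> T R M}" for k
    using Ms(1)[rule_format, of k] \<alpha>[of k] \<nu>[where k = k]
    by (intro CollectI exI[of _ "\<alpha> k"] exI[of _ "\<nu> k"]) simp
  then show "\<exists>Ms. (\<forall>k. Ms k \<in> {M. \<exists>\<alpha> \<nu> p \<pi> T R. 0 < \<alpha> \<and> \<alpha> < 1 \<and> (\<forall>j. 0 < \<nu> $ j) \<and> (\<forall>j. \<alpha> * \<nu> $ j = c $ j) \<and>
          admissible p \<pi> T R \<and> is_MPH_star_power \<nu> \<alpha> \<pi> T R M}) \<and> converges_weakly Ms M"
    using Ms(2) by (intro exI[of _ Ms] conjI allI)
qed (auto dest: is_MPH_star_power_orthant)

theorem theorem3p6: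
  shows
    "weakly_dense_in
       {M :: (real^'n) measure. \<exists>\<alpha> p \<pi> T R.
          0 < \<alpha> \<and> \<alpha> \<le> 1 \<and> admissible p \<pi> T R \<and> is_MPH_star \<alpha> \<pi> T R M}
       orthant_distributions
     \<and>
     (\<forall>\<alpha>. 0 < \<alpha> \<and> \<alpha> \<le> 1 \<longrightarrow>
       weakly_dense_in
         {M :: (real^'n) measure. \<exists>\<nu> p \<pi> T R.
            (\<forall>j. 0 < \<nu> $ j) \<and> admissible p \<pi> T R \<and> is_MPH_star_power \<nu> \<alpha> \<pi> T R M}
         orthant_distributions)
     \<and>
     (\<forall>c :: real^'n. (\<forall>j. 0 < c $ j) \<longrightarrow>
       weakly_dense_in
         {M :: (real^'n) measure. \<exists>\<alpha> \<nu> p \<pi> T R.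
            0 < \<alpha> \<and> \<alpha> < 1 \<and> (\<forall>j. 0 < \<nu> $ j) \<and> (\<forall>j. \<alpha> * \<nu> $ j = c $ j) \<and>
            admissible p \<pi> T R \<and> is_MPH_star_power \<nu> \<alpha> \<pi> T R M}
         orthant_distributions)"
  using MPH_star_weakly_dense MPH_star_power_weakly_dense_fixed_order MPH_star_power_weakly_dense_fixed_tail
  by (intro conjI allI impI)

end
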